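(* Let $\mathcal{P}$ be a distribution on Boolean constraints of arity $k$ such that $SAT(\mathcal{P})$ has a sharp threshold, and suppose no constraint in $\mathcal{C}=\mathrm{supp}(\mathcal{P})$ has an implicate of length at most $2$. Then: (1) every minimally unsatisfiable formula $F$ over $\mathcal{C}$ satisfies $c^{*}(F)\geq \frac{2}{2k-3}$; consequently $SAT(\mathcal{P})$ has a first-order phase transition; (2) $SAT(\mathcal{P})$ has $2^{\Omega(n)}$ resolution complexity: for every constant $c>0$ there is $\eta>0$ such that, with probability tending to $1$, every resolution refutation of (the CNF encoding of) a random formula from $SAT_{n,cn}(\mathcal{P})$ has size at least $2^{\eta n}$.
   Context: A Boolean constraint of arity $k$ is a nonempty subset of $\{0,1\}^k$ of allowed assignments. A formula over $\mathcal{C}$ is a conjunction of constraints from $\mathcal{C}$ each applied to an ordered $k$-tuple of distinct variables. Random model $SAT_{n,M}(\mathcal{P})$: on $n$ variables, choose $M$ $k$-subsets of variables uniformly at random with repetition; for each, take a uniformly random ordering of its variables and apply a constraint drawn according to $\mathcal{P}$. Sharp threshold: there is $c(n)$ bounded away from $0$ such that for every $\epsilon>0$ the random formula is satisfiable with probability $\to1$ when $M<(c(n)-\epsilon)n$ and with probability $\to0$ when $M>(c(n)+\epsilon)n$. A clause $D$ is an implicate of a constraint $C$ if every satisfying assignment of $C$ satisfies $D$; its length is its number of literals. A formula is minimally unsatisfiable if it is unsatisfiable but every proper subformula is satisfiable. $c^{*}(F)=\max\{|Constraints(G)|/|Var(G)| : \emptyset\neq G\subseteq F\}$. Spine: $Spine(\Phi)$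 is the set of variables $x$ such that there exist a satisfiable subformula $\Xi\subseteq\Phi$ and a constraint from $\mathcal{C}$ applied to a tuple of variables containing $x$, call it $C$, with $\Xi\wedge C$ unsatisfiable. First-order phase transition: there exists $\eta>0$ such that for every sequence $M(n)$, with $\Phi$ from $SAT_{n,M(n)}(\mathcal{P})$, $\lim_n\Pr[\Phi\text{ satisfiable}]=0$ implies $\lim_n\Pr[|Spine(\Phi)|/n\geq\eta]=1$. Resolution refutations are taken of the CNF formula obtained by converting each constraint into CNF. *)

theory Defs
  imports "HOL-Probability.Probability" "HOL-Library.Multiset"
begin

text \<open>A Boolean constraint is given by its set of allowed assignments, each written as a list of
  Booleans; an application of a constraint pairs it with the tuple of variables it is applied to.
  Formulas are multisets of applications, since the random model draws with repetition.\<close>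

type_synonym constr = "bool list set"
type_synonym 'v formula = "(constr \<times> 'v list) multiset"

definition is_constraint :: "nat \<Rightarrow> constr \<Rightarrow> bool" where
  "is_constraint k R \<longleftrightarrow> R \<noteq> {} \<and> (\<forall>a\<in>R. length a = k)"

definition tuples :: "nat \<Rightarrow> 'v list set" where
  "tuples k = {xs. length xs = k \<and> distinct xs}"

definition formula_over :: "nat \<Rightarrow> constr set \<Rightarrow> 'v formula \<Rightarrow> bool" where
  "formula_over k \<C> F \<longleftrightarrow> set_mset F \<subseteq> \<C> \<times> tuples k"

definition Var :: "'v formula \<Rightarrow> 'v set" where
  "Var F = (\<Union>(R, xs)\<in>set_mset F. set xs)"

definition satisfies :: "('v \<Rightarrow> bool) \<Rightarrow> 'v formula \<Rightarrow> bool" where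
  "satisfies \<alpha> F \<longleftrightarrow> (\<forall>(R, xs)\<in>set_mset F. map \<alpha> xs \<in> R)"

definition satisfiable :: "'v formula \<Rightarrow> bool" where
  "satisfiable F \<longleftrightarrow> (\<exists>\<alpha>. satisfies \<alpha> F)"

definition minimally_unsat :: "'v formula \<Rightarrow> bool" where
  "minimally_unsat F \<longleftrightarrow> \<not> satisfiable F \<and> (\<forall>G. G \<subset># F \<longrightarrow> satisfiable G)"

definition c_star :: "'v formula \<Rightarrow> real" where
  "c_star F = Max {real (size G) / real (card (Var G)) | G. G \<noteq> {#} \<and> G \<subseteq># F}"


datatype 'v literal = Pos 'v | Neg 'v

type_synonym 'v clause = "'v literal set"

text \<open>Tautological sets of literals do not count as clauses: with them, every constraint of
  positive arity would have the implicate \<open>x \<or> \<not> x\<close> of length 2.\<close>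

definition is_clause :: "'v clause \<Rightarrow> bool" where
  "is_clause D \<longleftrightarrow> finite D \<and> \<not> (\<exists>x. Pos x \<in> D \<and> Neg x \<in> D)"

fun lit_true :: "('v \<Rightarrow> bool) \<Rightarrow> 'v literal \<Rightarrow> bool" where
  "lit_true \<alpha> (Pos x) = \<alpha> x"
| "lit_true \<alpha> (Neg x) = (\<not> \<alpha> x)"

definition clause_true :: "('v \<Rightarrow> bool) \<Rightarrow> 'v clause \<Rightarrow> bool" where
  "clause_true \<alpha> D \<longleftrightarrow> (\<exists>l\<in>D. lit_true \<alpha> l)"

text \<open>The \<open>i\<close>-th argument of a constraint of arity \<open>k\<close> is represented by the variable \<open>i < k\<close>.\<close>

definition implicate :: "nat \<Rightarrow> constr \<Rightarrow> nat clause \<Rightarrow> bool" where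
  "implicate k R D \<longleftrightarrow> is_clause D \<and> (\<Union>l\<in>D. set_literal l) \<subseteq> {..<k} \<and>
     (\<forall>\<alpha>. map \<alpha> [0..<k] \<in> R \<longrightarrow> clause_true \<alpha> D)"


text \<open>The random models below are meaningful for \<open>k \<le> n\<close> only, as otherwise there is no
  \<open>k\<close>-subset to choose; all statements about them are asymptotic in \<open>n\<close>.\<close>

definition random_application :: "nat \<Rightarrow> constr pmf \<Rightarrow> nat \<Rightarrow> (constr \<times> nat list) pmf" where
  "random_application k P n =
     do {
       V \<leftarrow> pmf_of_set {V. V \<subseteq> {..<n} \<and> card V = k};
       xs \<leftarrow> pmf_of_set {xs. set xs = V \<and> distinct xs};
       R \<leftarrow> P;
       return_pmf (R, xs)
     }"

definition SAT_model :: "nat \<Rightarrow> constr pmf \<Rightarrow> nat \<Rightarrow> nat \<Rightarrow> nat formula pmf" where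
  "SAT_model k P n M = map_pmf mset (replicate_pmf M (random_application k P n))"

abbreviation prob_sat :: "nat \<Rightarrow> constr pmf \<Rightarrow> nat \<Rightarrow> nat \<Rightarrow> real" where
  "prob_sat k P n M \<equiv> measure_pmf.prob (SAT_model k P n M) {\<Phi>. satisfiable \<Phi>}"

definition sharp_threshold :: "nat \<Rightarrow> constr pmf \<Rightarrow> bool" where
  "sharp_threshold k P \<longleftrightarrow>
     (\<exists>c :: nat \<Rightarrow> real. (\<exists>\<delta>>0. \<forall>n. \<delta> \<le> c n) \<and>
       (\<forall>\<epsilon>>0. \<forall>M :: nat \<Rightarrow> nat.
          ((\<forall>\<^sub>F n in sequentially. real (M n) < (c n - \<epsilon>) * real n) \<longrightarrow>
             (\<lambda>n. prob_sat k P n (M n)) \<longlonglongrightarrow> 1) \<and>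
          ((\<forall>\<^sub>F n in sequentially. real (M n) > (c n + \<epsilon>) * real n) \<longrightarrow>
             (\<lambda>n. prob_sat k P n (M n)) \<longlonglongrightarrow> 0)))"

definition Spine :: "nat \<Rightarrow> constr set \<Rightarrow> nat \<Rightarrow> nat formula \<Rightarrow> nat set" where
  "Spine k \<C> n \<Phi> =
     {x. \<exists>\<Xi> R xs. \<Xi> \<subseteq># \<Phi> \<and> satisfiable \<Xi> \<and>
        R \<in> \<C> \<and> xs \<in> tuples k \<and> set xs \<subseteq> {..<n} \<and> x \<in> set xs \<and>
        \<not> satisfiable (add_mset (R, xs) \<Xi>)}"

definition first_order_phase_transition :: "nat \<Rightarrow> constr pmf \<Rightarrow> bool" where
  "first_order_phase_transition k P \<longleftrightarrow>
     (\<exists>\<eta>>0. \<forall>M :: nat \<Rightarrow> nat.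
        (\<lambda>n. prob_sat k P n (M n)) \<longlonglongrightarrow> 0 \<longrightarrow>
        (\<lambda>n. measure_pmf.prob (SAT_model k P n (M n))
               {\<Phi>. real (card (Spine k (set_pmf P) n \<Phi>)) / real n \<ge> \<eta>}) \<longlonglongrightarrow> 1)"


text \<open>A conversion to CNF assigns to every constraint an equivalent set of clauses over its
  argument positions \<open>{..<k}\<close>; an application instantiates the positions by its variables.\<close>

definition cnf_conversion :: "nat \<Rightarrow> constr set \<Rightarrow> (constr \<Rightarrow> nat clause set) \<Rightarrow> bool" where
  "cnf_conversion k \<C> enc \<longleftrightarrow>
     (\<forall>R\<in>\<C>. (\<forall>D\<in>enc R. is_clause D \<and> (\<Union>l\<in>D. set_literal l) \<subseteq> {..<k}) \<and>
             (\<forall>\<alpha>. map \<alpha> [0..<k] \<in> R \<longleftrightarrow> (\<forall>D\<in>enc R. clause_true \<alpha> D)))"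

definition cnf_of :: "(constr \<Rightarrow> nat clause set) \<Rightarrow> 'v formula \<Rightarrow> 'v clause set" where
  "cnf_of enc F =
     (\<Union>(R, xs)\<in>set_mset F. (\<lambda>D. map_literal (\<lambda>i. xs ! i) ` D) ` enc R)"

text \<open>The canonical conversion has one clause of length \<open>k\<close> for every forbidden assignment.\<close>

definition canonical_cnf :: "nat \<Rightarrow> constr \<Rightarrow> nat clause set" where
  "canonical_cnf k R =
     {(\<lambda>i. if a ! i then Neg i else Pos i) ` {..<k} | a. length a = k \<and> a \<notin> R}"

lemma cnf_conversion_canonical: "cnf_conversion k \<C> (canonical_cnf k)"
proof -
  have clause: "is_clause D \<and> (\<Union>l\<in>D. set_literal l) \<subseteq> {..<k}"
    if "D \<in> canonical_cnf k R" for D R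
    using that by (fastforce simp: canonical_cnf_def is_clause_def split: if_splits)
  have "map \<alpha> [0..<k] \<in> R \<longleftrightarrow> (\<forall>D\<in>canonical_cnf k R. clause_true \<alpha> D)" for \<alpha> R
  proof -
    have "clause_true \<alpha> ((\<lambda>i. if a ! i then Neg i else Pos i) ` {..<k}) \<longleftrightarrow>
        a \<noteq> map \<alpha> [0..<k]" if "length a = k" for a
    proof -
      have "lit_true \<alpha> (if a ! i then Neg i else Pos i) \<longleftrightarrow> a ! i \<noteq> \<alpha> i" for i
        by simp
      then have "clause_true \<alpha> ((\<lambda>i. if a ! i then Neg i else Pos i) ` {..<k}) \<longleftrightarrow>
          (\<exists>i\<in>{..<k}. a ! i \<noteq> \<alpha> i)"
        unfolding clause_true_def Set.bex_simps(7) by (rule bex_cong[OF refl])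
      also have "\<dots> \<longleftrightarrow> a \<noteq> map \<alpha> [0..<k]"
        using that by (simp add: list_eq_iff_nth_eq Bex_def)
      finally show ?thesis .
    qed
    then have "(\<forall>D\<in>canonical_cnf k R. clause_true \<alpha> D) \<longleftrightarrow>
        (\<forall>a. length a = k \<and> a \<notin> R \<longrightarrow> a \<noteq> map \<alpha> [0..<k])"
      unfolding canonical_cnf_def by blast
    also have "\<dots> \<longleftrightarrow> map \<alpha> [0..<k] \<in> R"
      by (metis length_map length_upt minus_nat.diff_0)
    finally show ?thesis ..
  qed
  with clause show ?thesis
    unfolding cnf_conversion_def by blast
qed

definition resolvent :: "'v clause \<Rightarrow> 'v clause \<Rightarrow> 'v \<Rightarrow> 'v clause" where
  "resolvent D E x = (D - {Pos x}) \<union> (E - {Neg x})"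

text \<open>Refutations are sequences of clauses (dag-like); the size is the number of clauses.\<close>

definition resolution_refutation :: "'v clause set \<Rightarrow> 'v clause list \<Rightarrow> bool" where
  "resolution_refutation S \<pi> \<longleftrightarrow> \<pi> \<noteq> [] \<and> last \<pi> = {} \<and>
     (\<forall>i<length \<pi>. \<pi> ! i \<in> S \<or>
        (\<exists>j<i. \<exists>l<i. \<exists>x. Pos x \<in> \<pi> ! j \<and> Neg x \<in> \<pi> ! l \<and> \<pi> ! i = resolvent (\<pi> ! j) (\<pi> ! l) x))"

definition exponential_resolution_complexity ::
  "nat \<Rightarrow> constr pmf \<Rightarrow> (constr \<Rightarrow> nat clause set) \<Rightarrow> bool" where
  "exponential_resolution_complexity k P enc \<longleftrightarrow>
     (\<forall>c>0. \<exists>\<eta>>0.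
        (\<lambda>n. measure_pmf.prob (SAT_model k P n (nat \<lfloor>c * real n\<rfloor>))
               {\<Phi>. \<forall>\<pi>. resolution_refutation (cnf_of enc \<Phi>) \<pi> \<longrightarrow>
                        2 powr (\<eta> * real n) \<le> real (length \<pi>)}) \<longlonglongrightarrow> 1)"

end

theory Submission
  imports Defs "HOL-Probability.Product_PMF"
begin

text \<open>In a formula that minimally entails a clause \<open>D\<close>, call a variable of a constraint private if no
  other constraint contains it. If no private variable of a constraint occurs in \<open>D\<close>, then at least
  three of its variables are not private: otherwise an assignment that satisfies all other
  constraints and falsifies \<open>D\<close> could be changed on the private variables so as to satisfy this
  constraint too, since there is no implicate of length at most 2 to prevent it. Counting
  incidences gives \<open>2 * |Var| + 3 * |F| \<le> 2 * k * |F| + 3 * |D|\<close>. For \<open>D = {}\<close> this is the bound on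
  \<open>c_star\<close>.

  With high probability every subformula of a random formula with \<open>r \<le> \<eta> n\<close> constraints has at
  least \<open>(k - 5/4) r\<close> variables. Since \<open>k - 5/4 > k - 3/2\<close>, minimally unsatisfiable subformulas are
  then of linear size, and all their variables lie in the spine. Likewise, a clause entailed
  minimally by \<open>r \<le> \<eta> n\<close> constraints has at least \<open>r / 6\<close> literals, so that refutations need
  linear width and, by the size-width trade-off, exponential size. A sharp threshold enters only
  through the fact that neither constant assignment satisfies all constraints, which yields
  unsatisfiability at linear density by the first moment method.\<close>

section \<open>Minimal entailment and expansion\<close>

definition clause_vars :: "'v clause \<Rightarrow> 'v set" where
  "clause_vars D = (\<Union>l\<in>D. set_literal l)"

definition entails :: "'v formula \<Rightarrow> 'v clause \<Rightarrow> bool" where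
  "entails F D \<longleftrightarrow> (\<forall>\<alpha>. satisfies \<alpha> F \<longrightarrow> clause_true \<alpha> D)"

lemma entails_empty_iff: "entails F {} \<longleftrightarrow> \<not> satisfiable F"
  by (simp add: entails_def clause_true_def satisfiable_def)

lemma entails_mono: "entails F D \<Longrightarrow> set_mset F \<subseteq> set_mset G \<Longrightarrow> entails G D"
  unfolding entails_def satisfies_def by (meson subsetD)

lemma finite_set_literal [simp]: "finite (set_literal l)"
  by (cases l) auto

lemma card_clause_vars_le:
  assumes "finite D"
  shows "card (clause_vars D) \<le> card D"
proof -
  have 1: "card (set_literal l) = 1" for l :: "'a literal"
    by (cases l) auto
  have "card (clause_vars D) \<le> (\<Sum>l\<in>D. card (set_literal l))"
    unfolding clause_vars_def using assms by (rule card_UN_le)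
  then show ?thesis by (simp add: 1)
qed

lemma clause_true_cong:
  assumes "\<And>x. x \<in> clause_vars D \<Longrightarrow> \<alpha> x = \<beta> x"
  shows "clause_true \<alpha> D \<longleftrightarrow> clause_true \<beta> D"
proof -
  have "lit_true \<alpha> l \<longleftrightarrow> lit_true \<beta> l" if "l \<in> D" for l
    using assms that by (cases l) (auto simp: clause_vars_def, (metis UN_I literal.set_intros)+)
  then show ?thesis unfolding clause_true_def by auto
qed

lemma finite_Var [simp]: "finite (Var F)"
  by (auto simp: Var_def)

lemma Var_mono: "set_mset F \<subseteq> set_mset G \<Longrightarrow> Var F \<subseteq> Var G"
  by (fastforce simp: Var_def)

lemma exists_minimal_subformula:
  assumes "Q F"
  shows "\<exists>G. G \<subseteq># F \<and> Q G \<and> (\<forall>H. H \<subset># G \<longrightarrow> \<not> Q H)"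
  using assms
proof (induction "size F" arbitrary: F rule: less_induct)
  case less
  show ?case
  proof (cases "\<exists>H. H \<subset># F \<and> Q H")
    case True
    then obtain H where H: "H \<subset># F" "Q H" by blast
    from less(1)[OF mset_subset_size[OF H(1)] H(2)] H(1) show ?thesis
      by (meson subset_mset.less_imp_le subset_mset.order_trans)
  next
    case False
    with less(2) show ?thesis by blast
  qed
qed

text \<open>Were no allowed assignment to agree with \<open>\<beta>\<close> on \<open>J\<close>, the
  clause "differs from \<open>\<beta>\<close> somewhere on \<open>J\<close>" would be an implicate
  with at most two literals.\<close>

lemma extend_if_no_short_implicate:
  assumes noimp: "\<And>D. implicate k R D \<Longrightarrow> \<not> card D \<le> 2"
    and J: "J \<subseteq> {..<k}" "card J \<le> 2"
  obtains \<gamma> where "map \<gamma> [0..<k] \<in> R" "\<And>i. i \<in> J \<Longrightarrow> \<gamma> i = \<beta> i"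
proof (rule ccontr)
  assume contra: "\<not> thesis"
  let ?D = "(\<lambda>i. if \<beta> i then Neg i else Pos i) ` J"
  have fJ: "finite J" using J(1) finite_subset by blast
  have "implicate k R ?D"
    unfolding implicate_def
  proof (intro conjI allI impI)
    show "is_clause ?D" using fJ by (auto simp: is_clause_def split: if_splits)
    show "(\<Union>l\<in>?D. set_literal l) \<subseteq> {..<k}" using J(1) by (auto split: if_splits)
  next
    fix \<alpha> assume "map \<alpha> [0..<k] \<in> R"
    with contra that obtain i where "i \<in> J" "\<alpha> i \<noteq> \<beta> i" by metis
    then have "lit_true \<alpha> (if \<beta> i then Neg i else Pos i)" by auto
    with \<open>i \<in> J\<close> show "clause_true \<alpha> ?D" unfolding clause_true_def by blast
  qed
  moreover have "card ?D \<le> 2"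
    using J(2) card_image_le[OF fJ, of "\<lambda>i. if \<beta> i then Neg i else Pos i"] by linarith
  ultimately show False using noimp by blast
qed

lemma minimal_entailing_vars:
  fixes F :: "'v formula"
  assumes over: "formula_over k \<C> F"
    and noimp: "\<And>R D. R \<in> \<C> \<Longrightarrow> implicate k R D \<Longrightarrow> \<not> card D \<le> 2"
    and fin: "finite D" and ent: "entails F D"
    and min: "\<And>G. G \<subset># F \<Longrightarrow> \<not> entails G D"
  shows "2 * card (Var F) + 3 * size F \<le> 2 * k * size F + 3 * card D"
proof -
  define A where "A = set_mset F"
  have finA [simp]: "finite A" by (simp add: A_def)
  \<comment> \<open>Entailment depends only on the set of constraints, so a repeated one could lose
    a copy. Minimality thus lets the set \<open>A\<close> stand for the multiset
    \<open>F\<close>.\<close>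
  have cnt: "count F c = 1" if "c \<in> A" for c
  proof (rule ccontr)
    assume "count F c \<noteq> 1"
    with that have "c \<in># F - {#c#}"
      by (metis A_def count_greater_zero_iff count_single in_diff_count less_one nat_neq_iff)
    then have "set_mset F \<subseteq> set_mset (F - {#c#})"
      by (metis A_def insert_DiffM insert_absorb set_mset_add_mset_insert subset_refl that)
    with ent have "entails (F - {#c#}) D" by (rule entails_mono)
    moreover have "F - {#c#} \<subset># F" using that by (simp add: A_def mset_subset_diff_self)
    ultimately show False using min by blast
  qed
  have sizeF: "size F = card A"
    using cnt by (simp add: size_multiset_overloaded_eq A_def)
  have tup: "length (snd c) = k" "distinct (snd c)" "fst c \<in> \<C>" if "c \<in> A" for c
    using over that by (auto simp: formula_over_def tuples_def A_def)
  have card_vars: "card (set (snd c)) = k" if "c \<in> A" for c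
    using tup[OF that] by (simp add: distinct_card)
  define priv where
    "priv c = {x \<in> set (snd c). \<forall>c'\<in>A. x \<in> set (snd c') \<longrightarrow> c' = c}" for c
  have priv_sub: "priv c \<subseteq> set (snd c)" for c by (auto simp: priv_def)
  have finp [simp]: "finite (priv c)" for c using priv_sub finite_subset by blast
  have shared: "card (priv c) + 3 \<le> k" if c: "c \<in> A" and out: "priv c \<inter> clause_vars D = {}" for c
  proof (rule ccontr)
    assume few: "\<not> card (priv c) + 3 \<le> k"
    obtain R xs where Rxs: "c = (R, xs)" by force
    have xs: "length xs = k" "distinct xs" "R \<in> \<C>" using tup[OF c] Rxs by auto
    have "F - {#c#} \<subset># F" using c by (simp add: A_def mset_subset_diff_self)
    with min obtain \<alpha> where \<alpha>: "satisfies \<alpha> (F - {#c#})" "\<not> clause_true \<alpha> D"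
      unfolding entails_def by blast
    define J where "J = {i. i < k \<and> xs ! i \<notin> priv c}"
    have "(!) xs ` J = set xs - priv c"
      using xs by (auto simp: J_def in_set_conv_nth)
    moreover have "inj_on ((!) xs) J"
      using xs by (auto simp: J_def inj_on_def nth_eq_iff_index_eq)
    ultimately have "card J = card (set xs - priv c)"
      by (metis card_image)
    also have "\<dots> = k - card (priv c)"
      using priv_sub[of c] card_vars[OF c] Rxs by (simp add: card_Diff_subset)
    finally have "card J \<le> 2" using few by linarith
    moreover have "J \<subseteq> {..<k}" by (auto simp: J_def)
    ultimately obtain \<gamma> where \<gamma>: "map \<gamma> [0..<k] \<in> R" "\<And>i. i \<in> J \<Longrightarrow> \<gamma> i = \<alpha> (xs ! i)"
      using extend_if_no_short_implicate[where J = J and \<beta> = "\<lambda>i. \<alpha> (xs ! i)", OF noimp[OF xs(3)]]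
      by blast
    \<comment> \<open>\<open>\<gamma>\<close> is indexed by positions; since \<open>xs\<close> is
      distinct, \<open>THE\<close> recovers the position of a private variable. Only private
      variables are changed, so all other constraints keep their values.\<close>
    define \<beta> where "\<beta> x = (if x \<in> priv c then \<gamma> (THE i. i < k \<and> xs ! i = x) else \<alpha> x)" for x
    have "\<beta> (xs ! i) = \<gamma> i" if "i < k" for i
    proof (cases "i \<in> J")
      case True
      then show ?thesis using \<gamma>(2)[of i] by (simp add: \<beta>_def J_def)
    next
      case False
      then have "xs ! i \<in> priv c" using that by (simp add: J_def)
      moreover have "(THE j. j < k \<and> xs ! j = xs ! i) = i"
        using xs that by (intro the_equality) (auto simp: nth_eq_iff_index_eq)
      ultimately show ?thesis by (simp add: \<beta>_def)
    qed
    then have "map \<beta> xs = map \<gamma> [0..<k]"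
      using xs by (intro nth_equalityI) auto
    with \<gamma>(1) have sat_c: "map \<beta> xs \<in> R" by simp
    have "map \<beta> ys \<in> R'" if "(R', ys) \<in># F" for R' ys
    proof (cases "(R', ys) = c")
      case True
      then show ?thesis using sat_c Rxs by simp
    next
      case False
      with that have "(R', ys) \<in># F - {#c#}"
        by (auto simp: in_diff_count)
      with \<alpha>(1) have "map \<alpha> ys \<in> R'" by (auto simp: satisfies_def)
      moreover have "map \<beta> ys = map \<alpha> ys"
        using False that by (auto simp: \<beta>_def priv_def A_def)
      ultimately show ?thesis by metis
    qed
    then have "satisfies \<beta> F" by (auto simp: satisfies_def)
    moreover have "clause_true \<beta> D \<longleftrightarrow> clause_true \<alpha> D"
      using out by (intro clause_true_cong) (auto simp: \<beta>_def)
    ultimately show False using ent \<alpha>(2) unfolding entails_def by blast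
  qed
  \<comment> \<open>\<open>shared\<close> says nothing about these constraints. Each owns a private
    variable that occurs in \<open>D\<close>, and different constraints own different ones, so there
    are at most \<open>card D\<close> of them; the slack of 3 per such constraint becomes the term
    \<open>3 * card D\<close>.\<close>
  define bad where "bad = {c \<in> A. priv c \<inter> clause_vars D \<noteq> {}}"
  have [simp]: "finite bad" by (simp add: bad_def)
  have bad_sub: "bad \<subseteq> A" by (auto simp: bad_def)
  have card_bad: "card bad \<le> card D"
  proof -
    have "\<forall>c\<in>bad. \<exists>x. x \<in> priv c \<inter> clause_vars D" by (auto simp: bad_def)
    then obtain f where f: "\<And>c. c \<in> bad \<Longrightarrow> f c \<in> priv c \<inter> clause_vars D" by metis
    have "inj_on f bad"
    proof (rule inj_onI)
      fix c c' assume "c \<in> bad" "c' \<in> bad" "f c = f c'"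
      then show "c = c'" using f[of c] f[of c'] bad_sub by (auto simp: priv_def)
    qed
    moreover have "f ` bad \<subseteq> clause_vars D" using f by blast
    moreover have "finite (clause_vars D)" using fin by (simp add: clause_vars_def)
    ultimately have "card bad \<le> card (clause_vars D)" by (rule card_inj_on_le)
    with card_clause_vars_le[OF fin] show ?thesis by linarith
  qed
  have "(\<Sum>c\<in>A. card (priv c) + 3) \<le> (\<Sum>c\<in>A. k + (if c \<in> bad then 3 else 0))"
  proof (rule sum_mono)
    fix c assume c: "c \<in> A"
    show "card (priv c) + 3 \<le> k + (if c \<in> bad then 3 else 0)"
      using shared[OF c] c card_mono[OF _ priv_sub, of c] card_vars[OF c]
      by (auto simp: bad_def)
  qed
  also have "\<dots> = k * card A + 3 * card bad"
    using bad_sub by (simp add: sum.distrib sum.If_cases Int_absorb1)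
  finally have 1: "(\<Sum>c\<in>A. card (priv c)) + 3 * card A \<le> k * card A + 3 * card D"
    using card_bad by (simp add: sum.distrib)
  have Var: "Var F = (\<Union>c\<in>A. set (snd c))"
    by (auto simp: Var_def A_def)
  have "2 * card (Var F) = (\<Sum>x\<in>Var F. 2)" by simp
  \<comment> \<open>Double counting of incidences, private ones with weight 2: a private variable
    gets 2 from its only constraint, any other gets 1 from each of at least two constraints.\<close>
  also have "\<dots> \<le> (\<Sum>x\<in>Var F. \<Sum>c\<in>A. of_bool (x \<in> set (snd c)) + of_bool (x \<in> priv c))"
  proof (rule sum_mono)
    fix x assume "x \<in> Var F"
    then obtain c where c: "c \<in> A" "x \<in> set (snd c)" by (auto simp: Var)
    let ?g = "\<lambda>c. of_bool (x \<in> set (snd c)) + of_bool (x \<in> priv c) :: nat"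
    show "2 \<le> sum ?g A"
    proof (cases "x \<in> priv c")
      case True
      then have "2 \<le> sum ?g {c}" using c by simp
      also have "\<dots> \<le> sum ?g A" using c by (intro sum_mono2) auto
      finally show ?thesis .
    next
      case False
      then obtain c' where c': "c' \<in> A" "x \<in> set (snd c')" "c' \<noteq> c" using c by (auto simp: priv_def)
      then have "2 \<le> sum ?g {c, c'}" using c by simp
      also have "\<dots> \<le> sum ?g A" using c c' by (intro sum_mono2) auto
      finally show ?thesis .
    qed
  qed
  also have "\<dots> = (\<Sum>c\<in>A. \<Sum>x\<in>Var F. of_bool (x \<in> set (snd c)) + of_bool (x \<in> priv c))"
    by (rule sum.swap)
  also have "\<dots> = (\<Sum>c\<in>A. k + card (priv c))"
  proof (rule sum.cong[OF refl])
    fix c assume c: "c \<in> A"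
    have "set (snd c) \<subseteq> Var F" using c by (auto simp: Var)
    then have "Var F \<inter> {x. x \<in> set (snd c)} = set (snd c)" "Var F \<inter> {x. x \<in> priv c} = priv c"
      using priv_sub[of c] by auto
    then show "(\<Sum>x\<in>Var F. of_bool (x \<in> set (snd c)) + of_bool (x \<in> priv c)) = k + card (priv c)"
      using card_vars[OF c] by (simp add: sum.distrib of_bool_def sum.If_cases)
  qed
  finally have "2 * card (Var F) \<le> k * card A + (\<Sum>c\<in>A. card (priv c))"
    by (simp add: sum.distrib mult.commute)
  with 1 show ?thesis by (simp add: sizeF)
qed

text \<open>In real numbers the inequality is |Var G| \<ge> (k - 5/4) |G|, scaled by 4 to stay free
  of subtraction. The constant must lie below 3/2 to beat minimal entailment and above 1 for the
  union bound to converge; 5/4 is one such choice.\<close>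

definition expanding :: "nat \<Rightarrow> real \<Rightarrow> 'v formula \<Rightarrow> bool" where
  "expanding k s F \<longleftrightarrow>
     (\<forall>G. G \<subseteq># F \<longrightarrow> real (size G) \<le> s \<longrightarrow> 4 * k * size G \<le> 4 * card (Var G) + 5 * size G)"

lemma formula_over_mono: "formula_over k \<C> F \<Longrightarrow> G \<subseteq># F \<Longrightarrow> formula_over k \<C> G"
  using set_mset_mono[of G F] by (auto simp: formula_over_def)

text \<open>Doubling the bound of \<open>minimal_entailing_vars\<close> and inserting the expansion
  cancels both \<open>Var G\<close> and the terms with \<open>k\<close>, leaving 6 |G| - 5 |G| \<le>
  6 |D|.\<close>

lemma expanding_minimal_size:
  assumes "formula_over k \<C> F" "\<And>R D. R \<in> \<C> \<Longrightarrow> implicate k R D \<Longrightarrow> \<not> card D \<le> 2"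
    and "expanding k s F" "finite D"
    and "G \<subseteq># F" "real (size G) \<le> s" "entails G D" "\<And>H. H \<subset># G \<Longrightarrow> \<not> entails H D"
  shows "size G \<le> 6 * card D"
proof -
  have "2 * card (Var G) + 3 * size G \<le> 2 * k * size G + 3 * card D"
    using assms by (intro minimal_entailing_vars[where \<C> = \<C>] formula_over_mono[of k \<C> F G]) auto
  moreover have "4 * k * size G \<le> 4 * card (Var G) + 5 * size G"
    using assms unfolding expanding_def by blast
  ultimately show ?thesis by linarith
qed

section \<open>Resolution width and size\<close>

text \<open>Resolution with built-in weakening, in which only clauses from \<open>T\<close> may occur. Refutations
  of small size and of small width are both derivations of this kind, for different \<open>T\<close>.\<close>

inductive der :: "'v clause set \<Rightarrow> 'v clause set \<Rightarrow> 'v clause \<Rightarrow> bool" for S T where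
  axiom: "E \<in> S \<Longrightarrow> E \<subseteq> D \<Longrightarrow> D \<in> T \<Longrightarrow> der S T D"
| resolve: "der S T D \<Longrightarrow> der S T E \<Longrightarrow> D - {Pos x} \<subseteq> G \<Longrightarrow> E - {Neg x} \<subseteq> G \<Longrightarrow> G \<in> T \<Longrightarrow> der S T G"

lemma der_weaken: "der S T D \<Longrightarrow> D \<subseteq> G \<Longrightarrow> G \<in> T \<Longrightarrow> der S T G"
  \<comment> \<open>Weakening is a degenerate resolution step: \<open>D\<close> is resolved with
    itself, and the variable does not matter since the premises need not contain it.\<close>
  using der.resolve[of S T D D undefined G] by blast

text \<open>Besides enlarging \<open>T\<close>, this exchanges axioms for clauses that have
  derivations from other axioms, as \<open>der_branch\<close> does.\<close>

lemma der_mono: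
  assumes "der S T D" "T \<subseteq> T'" "\<And>E D. E \<in> S \<Longrightarrow> E \<subseteq> D \<Longrightarrow> D \<in> T \<Longrightarrow> der S' T' D"
  shows "der S' T' D"
  using assms(1)
proof induction
  case (axiom E D)
  then show ?case using assms(3) by blast
next
  case (resolve D E x G)
  then show ?case using assms(2) by (blast intro: der.resolve[of S' T' D E x G])
qed

lemma resolution_refutation_der:
  assumes "resolution_refutation S \<pi>"
  shows "der S (set \<pi>) {}"
proof -
  have "der S (set \<pi>) (\<pi> ! i)" if "i < length \<pi>" for i
    using that
  proof (induction i rule: less_induct)
    case (less i)
    have mem: "\<pi> ! i \<in> set \<pi>" using less.prems by simp
    from assms less.prems consider "\<pi> ! i \<in> S"
      | j l x where "j < i" "l < i" "\<pi> ! i = resolvent (\<pi> ! j) (\<pi> ! l) x"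
      unfolding resolution_refutation_def by blast
    then show ?case
    proof cases
      case 1
      then show ?thesis using mem by (intro der.axiom) auto
    next
      case 2
      then have "der S (set \<pi>) (\<pi> ! j)" "der S (set \<pi>) (\<pi> ! l)"
        using less by auto
      then show ?thesis
        by (rule der.resolve[of S "set \<pi>" "\<pi> ! j" "\<pi> ! l" x])
          (use 2(3) mem in \<open>auto simp: resolvent_def\<close>)
    qed
  qed
  moreover have "\<pi> \<noteq> []" "last \<pi> = {}" using assms by (auto simp: resolution_refutation_def)
  ultimately show ?thesis by (metis diff_less last_conv_nth length_greater_0_conv zero_less_one)
qed

lemma resolve_true:
  assumes "clause_true \<alpha> D" "clause_true \<alpha> E" "D - {Pos x} \<subseteq> G" "E - {Neg x} \<subseteq> G"
  shows "clause_true \<alpha> G"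
proof -
  obtain l m where l: "l \<in> D" "lit_true \<alpha> l" and m: "m \<in> E" "lit_true \<alpha> m"
    using assms(1,2) by (auto simp: clause_true_def)
  have "l \<noteq> Pos x \<or> m \<noteq> Neg x" using l m by auto
  then show ?thesis using assms(3,4) l m by (auto simp: clause_true_def)
qed

text \<open>Measure a clause by the least number of constraints that entail it. This is at most 1
  for axioms and subadditive under resolution, while expansion leaves no clause of \<open>T\<close>
  with a measure above \<open>s\<close> and at most \<open>2 * s\<close>. Hence derived clauses
  never get past \<open>s\<close>; but expansion makes every subformula with at most
  \<open>s\<close> constraints satisfiable, so the empty clause is out of reach.\<close>

lemma expanding_width_bound:
  assumes over: "formula_over k \<C> F"
    and noimp: "\<And>R D. R \<in> \<C> \<Longrightarrow> implicate k R D \<Longrightarrow> \<not> card D \<le> 2"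
    and exp: "expanding k (2 * real s) F" and s: "s \<ge> 1"
    and S: "\<And>E. E \<in> S \<Longrightarrow> \<exists>c\<in>#F. entails {#c#} E"
    and T: "\<And>D. D \<in> T \<Longrightarrow> finite D \<and> 6 * card D \<le> s"
  shows "\<not> der S T {}"
proof
  assume "der S T {}"
  have step: "\<exists>G. G \<subseteq># F \<and> size G \<le> s \<and> entails G D"
    if H: "H \<subseteq># F" "size H \<le> 2 * s" "entails H D" and D: "D \<in> T" for H D
  proof -
    obtain G where G: "G \<subseteq># H" "entails G D" "\<And>K. K \<subset># G \<Longrightarrow> \<not> entails K D"
      using exists_minimal_subformula[of "\<lambda>H. entails H D", OF H(3)] by blast
    have GF: "G \<subseteq># F" using G H by auto
    have "size G \<le> 2 * s" using G H by (meson le_trans size_mset_mono)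
    then have "size G \<le> 6 * card D" using T[OF D]
      by (intro expanding_minimal_size[OF over noimp exp _ GF _ G(2,3)]) auto
    then have "size G \<le> s" using T[OF D] by linarith
    with GF G show ?thesis by blast
  qed
  have "\<exists>G. G \<subseteq># F \<and> size G \<le> s \<and> entails G D" if "der S T D" for D
    using that
  proof induction
    case (axiom E D)
    then obtain c where c: "c \<in># F" "entails {#c#} E" using S by blast
    from c(2) have "entails {#c#} D" using axiom(2)
      by (auto simp: entails_def clause_true_def)
    with c(1) s show ?case by (intro exI[of _ "{#c#}"]) auto
  next
    case (resolve D E x G)
    then obtain H K where H: "H \<subseteq># F" "size H \<le> s" "entails H D"
      and K: "K \<subseteq># F" "size K \<le> s" "entails K E" by blast
    \<comment> \<open>The union takes maximal multiplicities and so stays inside \<open>F\<close>;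
      the sum might not.\<close>
    have sub: "H \<union># K \<subseteq># F" using H K by simp
    have "H \<union># K \<subseteq># H + K" by (simp add: union_mset_def subset_mset.le_sup_iff)
    then have "size (H \<union># K) \<le> size (H + K)" by (rule size_mset_mono)
    then have size: "size (H \<union># K) \<le> 2 * s" using H K by simp
    have "entails (H \<union># K) D" "entails (H \<union># K) E"
      using H(3) K(3) by (auto elim: entails_mono)
    then have "entails (H \<union># K) G"
      using resolve_true[OF _ _ resolve(3,4)] unfolding entails_def by blast
    from step[OF sub size this resolve(5)] show ?case .
  qed
  from this[OF \<open>der S T {}\<close>] obtain G where G: "G \<subseteq># F" "size G \<le> s" "entails G {}" by blast
  then obtain H where H: "H \<subseteq># G" "entails H {}" "\<And>K. K \<subset># H \<Longrightarrow> \<not> entails K {}"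
    using exists_minimal_subformula[of "\<lambda>H. entails H {}", OF G(3)] by blast
  have HF: "H \<subseteq># F" using G H by auto
  have "size H \<le> s" using G H by (meson le_trans size_mset_mono)
  then have "size H \<le> 6 * card ({} :: 'a clause)"
    by (intro expanding_minimal_size[OF over noimp exp _ HF _ H(2,3)]) auto
  then have "H = {#}" by simp
  with H(2) show False by (simp add: entails_def satisfies_def clause_true_def)
qed

section \<open>Restriction by a literal and the size-width trade-off\<close>

fun compl :: "'v literal \<Rightarrow> 'v literal" where
  "compl (Pos x) = Neg x"
| "compl (Neg x) = Pos x"

definition assign :: "'v literal \<Rightarrow> 'v clause set \<Rightarrow> 'v clause set" where
  "assign l S = (\<lambda>D. D - {compl l}) ` {D \<in> S. l \<notin> D}"

text \<open>A step whose premises both avoid \<open>l\<close> survives the restriction as a step. If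
  it resolves on the variable of \<open>l\<close>, one premise survives and already gives the
  restricted conclusion by weakening.\<close>

lemma der_assign:
  assumes "der S T D" "l \<notin> D"
  shows "der (assign l S) (assign l T) (D - {compl l})"
  using assms
proof induction
  case (axiom E D)
  then show ?case by (intro der.axiom[of "E - {compl l}"]) (auto simp: assign_def)
next
  case (resolve D E x G)
  have G: "G - {compl l} \<in> assign l T" using resolve by (auto simp: assign_def)
  consider "l \<notin> D" "l \<notin> E" | "l = Pos x" | "l = Neg x"
    using resolve.hyps(3,4) resolve.prems by blast
  then show ?case
  proof cases
    case 1
    show ?thesis
    proof (rule der.resolve[OF _ _ _ _ G])
      show "der (assign l S) (assign l T) (D - {compl l})" using resolve.IH(1) 1 by blast
      show "der (assign l S) (assign l T) (E - {compl l})" using resolve.IH(2) 1 by blast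
      show "D - {compl l} - {Pos x} \<subseteq> G - {compl l}" using resolve.hyps(3) by blast
      show "E - {compl l} - {Neg x} \<subseteq> G - {compl l}" using resolve.hyps(4) by blast
    qed
  next
    case 2
    then have "l \<notin> E" "E - {compl l} \<subseteq> G - {compl l}" using resolve.hyps resolve.prems by auto
    then show ?thesis using der_weaken[OF resolve.IH(2) _ G] by blast
  next
    case 3
    then have "l \<notin> D" "D - {compl l} \<subseteq> G - {compl l}" using resolve.hyps resolve.prems by auto
    then show ?thesis using der_weaken[OF resolve.IH(1) _ G] by blast
  qed
qed

definition width_le :: "nat \<Rightarrow> 'v clause set" where
  "width_le w = {D. finite D \<and> card D \<le> w}"

lemma width_le_mono: "w \<le> w' \<Longrightarrow> width_le w \<subseteq> width_le w'"
  by (auto simp: width_le_def)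

lemma width_le_subset: "D \<in> width_le w \<Longrightarrow> E \<subseteq> D \<Longrightarrow> E \<in> width_le w"
  using card_mono[of D E] finite_subset[of E D] by (auto simp: width_le_def)

text \<open>Putting the deleted literal back into every clause turns steps into steps. For a
  refutation of the restriction the outcome is the unit clause \<open>{compl l}\<close>.\<close>

lemma der_unassign:
  assumes "der (assign l S) (width_le w) D"
  shows "der S (width_le (Suc w)) (insert (compl l) D)"
  using assms
proof induction
  case (axiom E D)
  then obtain E0 where "E0 \<in> S" "E = E0 - {compl l}" by (auto simp: assign_def)
  moreover have "insert (compl l) D \<in> width_le (Suc w)"
    using axiom by (auto simp: width_le_def card_insert_if)
  ultimately show ?case using axiom by (intro der.axiom[of E0]) auto
next
  case (resolve D E x G)
  have G: "insert (compl l) G \<in> width_le (Suc w)"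
    using resolve.hyps(5) by (auto simp: width_le_def card_insert_if)
  show ?case
    by (rule der.resolve[OF resolve.IH, of x]) (use resolve.hyps G in blast)+
qed

lemma compl_compl [simp]: "compl (compl l) = l"
  by (cases l) auto

lemma resolve_compl:
  assumes "der S T D" "der S T {compl l}" "D - {l} \<subseteq> G" "G \<in> T"
  shows "der S T G"
proof (cases l)
  case (Pos x)
  then show ?thesis using assms by (intro der.resolve[OF assms(1,2), of x]) auto
next
  case (Neg x)
  then show ?thesis using assms by (intro der.resolve[OF assms(2,1), of x]) auto
qed

text \<open>The refutation with \<open>l\<close> true gives the unit clause
  \<open>{compl l}\<close>. Resolving the axioms of \<open>S\<close> with it removes
  \<open>l\<close> and thus supplies the axioms of the other refutation. Only the branch with
  \<open>l\<close> true is charged a unit of width.\<close>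

lemma der_branch:
  assumes S: "S \<subseteq> width_le w"
    and "der (assign l S) (width_le w) {}"
    and "der (assign (compl l) S) (width_le (Suc w)) {}"
  shows "der S (width_le (Suc w)) {}"
  using assms(3)
proof (rule der_mono[OF _ order_refl])
  have unit: "der S (width_le (Suc w)) {compl l}" using der_unassign[OF assms(2)] .
  fix E D assume ED: "E \<in> assign (compl l) S" "E \<subseteq> D" "D \<in> width_le (Suc w)"
  then obtain E0 where E0: "E0 \<in> S" "E = E0 - {l}" by (auto simp: assign_def)
  then have "der S (width_le (Suc w)) E0"
    using S width_le_mono[of w "Suc w"] by (intro der.axiom[of E0]) auto
  from resolve_compl[OF this unit, of D] E0 ED show "der S (width_le (Suc w)) D" by auto
qed

definition fat :: "nat \<Rightarrow> 'v clause set \<Rightarrow> 'v clause set" where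
  "fat d T = {D \<in> T. d \<le> card D}"

lemma fat_assign_subset:
  assumes "\<And>D. D \<in> T \<Longrightarrow> finite D"
  shows "fat d (assign l T) \<subseteq> (\<lambda>D. D - {compl l}) ` {D \<in> fat d T. l \<notin> D}"
proof
  fix E assume "E \<in> fat d (assign l T)"
  then obtain D where D: "D \<in> T" "l \<notin> D" "E = D - {compl l}" "d \<le> card E"
    by (auto simp: fat_def assign_def)
  have "card E \<le> card D" using D assms by (auto intro: card_mono)
  with D show "E \<in> (\<lambda>D. D - {compl l}) ` {D \<in> fat d T. l \<notin> D}" by (auto simp: fat_def)
qed

lemma clause_vars_assign:
  assumes "clause_vars D \<subseteq> V" "l \<notin> D" "set_literal l = {x}"
  shows "clause_vars (D - {compl l}) \<subseteq> V - {x}"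
proof -
  have "m = l \<or> m = compl l" if "x \<in> set_literal m" for m
    using that assms(3) by (cases m; cases l) auto
  then show ?thesis using assms by (auto simp: clause_vars_def)
qed

lemma clause_subset_lits: "clause_vars D \<subseteq> V \<Longrightarrow> D \<subseteq> Pos ` V \<union> Neg ` V"
proof
  fix l assume "clause_vars D \<subseteq> V" "l \<in> D"
  then have "set_literal l \<subseteq> V" by (auto simp: clause_vars_def)
  then show "l \<in> Pos ` V \<union> Neg ` V" by (cases l) auto
qed

text \<open>Averaging: the fat clauses contain at least \<open>d * card (fat d T)\<close> literal
  occurrences in total, spread over at most \<open>2 * card V\<close> literals.\<close>

lemma frequent_literal:
  assumes "finite V" "finite T" "\<And>D. D \<in> T \<Longrightarrow> clause_vars D \<subseteq> V"
    and T: "fat d T \<noteq> {}" and d: "d \<ge> 1" "2 * real (card V) * \<rho> \<le> real d" "\<rho> \<ge> 0"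
  shows "\<exists>l \<in> Pos ` V \<union> Neg ` V. real (card {D \<in> fat d T. l \<in> D}) \<ge> \<rho> * real (card (fat d T))"
proof (rule ccontr)
  assume "\<not> ?thesis"
  then have less: "real (card {D \<in> fat d T. l \<in> D}) < \<rho> * real (card (fat d T))"
    if "l \<in> Pos ` V \<union> Neg ` V" for l using that by force
  let ?L = "Pos ` V \<union> Neg ` V" and ?A = "fat d T"
  have finA [simp]: "finite ?A" using assms(2) by (simp add: fat_def)
  have "finite ?L" using assms(1) by simp
  have sub: "D \<subseteq> ?L" if "D \<in> ?A" for D
    using that assms(3) by (intro clause_subset_lits) (auto simp: fat_def)
  have cardL: "card ?L \<le> 2 * card V"
    using card_Un_le[of "Pos ` V" "Neg ` V"] card_image_le[OF assms(1), of Pos]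
      card_image_le[OF assms(1), of Neg] by linarith
  obtain D where D: "D \<in> ?A" using T by blast
  then have "D \<noteq> {}" using d(1) by (auto simp: fat_def)
  then have ne: "?L \<noteq> {}" using sub[OF D] by auto
  have "d * card ?A = (\<Sum>D\<in>?A. d)" by simp
  also have "\<dots> \<le> (\<Sum>D\<in>?A. card D)" by (intro sum_mono) (auto simp: fat_def)
  also have "\<dots> = (\<Sum>D\<in>?A. \<Sum>l\<in>?L. of_bool (l \<in> D))"
  proof (rule sum.cong[OF refl])
    fix D assume "D \<in> ?A"
    then have "card D = (\<Sum>l\<in>?L \<inter> D. 1)" using sub by (simp add: Int_absorb1)
    also have "\<dots> = (\<Sum>l\<in>?L. of_bool (l \<in> D))"
      unfolding of_bool_def by (rule sum.inter_restrict) fact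
    finally show "card D = (\<Sum>l\<in>?L. of_bool (l \<in> D))" .
  qed
  also have "\<dots> = (\<Sum>l\<in>?L. \<Sum>D\<in>?A. of_bool (l \<in> D))" by (rule sum.swap)
  also have "\<dots> = (\<Sum>l\<in>?L. card {D \<in> ?A. l \<in> D})"
    by (simp add: of_bool_def sum.If_cases Int_def)
  finally have "real (d * card ?A) \<le> real (\<Sum>l\<in>?L. card {D \<in> ?A. l \<in> D})"
    by (rule of_nat_mono)
  then have "real d * real (card ?A) \<le> real (\<Sum>l\<in>?L. card {D \<in> ?A. l \<in> D})"
    by (simp only: of_nat_mult)
  also have "\<dots> = (\<Sum>l\<in>?L. real (card {D \<in> ?A. l \<in> D}))" by simp
  also have "\<dots> < (\<Sum>l\<in>?L. \<rho> * real (card ?A))"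
    using ne less \<open>finite ?L\<close> by (intro sum_strict_mono) auto
  also have "\<dots> = real (card ?L) * \<rho> * real (card ?A)" by simp
  also have "\<dots> \<le> (2 * real (card V)) * \<rho> * real (card ?A)"
    using cardL d(3) by (intro mult_right_mono) auto
  also have "\<dots> \<le> real d * real (card ?A)"
    using d(2) by (intro mult_right_mono) auto
  finally show False by simp
qed

lemma assign_width_le: "S \<subseteq> width_le w \<Longrightarrow> assign l S \<subseteq> width_le w"
  using width_le_subset[OF _ Diff_subset] unfolding assign_def by blast

text \<open>The size-width trade-off of Ben-Sasson and Wigderson: setting the literal that occurs most
  often in fat clauses to true shrinks the number of fat clauses by a factor \<open>1 - \<rho>\<close>, at the cost
  of one unit of width.\<close>

lemma size_width:
  assumes "finite V" "finite T" "\<And>D. D \<in> T \<Longrightarrow> clause_vars D \<subseteq> V"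
    and "der S T {}" "S \<subseteq> width_le K"
    and "d \<ge> 1" "2 * real (card V) * \<rho> \<le> real d" "0 \<le> \<rho>" "\<rho> < 1"
    and "real (card (fat d T)) * (1 - \<rho>) ^ b < 1"
  shows "der S (width_le (K + d + b)) {}"
  using assms
proof (induction "card V" arbitrary: V S T b rule: less_induct)
  case less
  have finD: "finite D" if "D \<in> T" for D
    using clause_subset_lits[OF less(4)[OF that]] less(2) by (meson finite_UnI finite_imageI finite_subset)
  have finfat: "finite (fat d T)" using less(3) by (simp add: fat_def)
  show ?case
  proof (cases "fat d T = {}")
    case True
    have sub: "T \<subseteq> width_le (K + d + b)"
    proof
      fix D assume "D \<in> T"
      with True have "card D < d" by (auto simp: fat_def)
      with finD[OF \<open>D \<in> T\<close>] show "D \<in> width_le (K + d + b)" by (auto simp: width_le_def)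
    qed
    show ?thesis
      by (rule der_mono[OF less(5) sub]) (use sub in \<open>blast intro: der.axiom\<close>)
  next
    case False
    then have "1 \<le> real (card (fat d T))" using finfat
      by (simp add: Suc_le_eq card_gt_0_iff)
    \<comment> \<open>With \<open>b = 0\<close> the hypothesis would read
      \<open>card (fat d T) < 1\<close>, so while fat clauses exist a unit of width is left to
      spend.\<close>
    then have "b \<noteq> 0" using less(11) by (intro notI) simp
    then obtain b' where b: "b = Suc b'" by (cases b) auto
    obtain l where l: "l \<in> Pos ` V \<union> Neg ` V"
      "real (card {D \<in> fat d T. l \<in> D}) \<ge> \<rho> * real (card (fat d T))"
      using frequent_literal[OF less(2,3,4) False less(7,8,9)] by blast
    then obtain x where x: "x \<in> V" "set_literal l = {x}" "set_literal (compl l) = {x}" by auto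
    have V': "card (V - {x}) < card V" "finite (V - {x})"
      using less(2) card_Diff1_less[OF less(2) x(1)] by auto
    have "real (card (V - {x})) * \<rho> \<le> real (card V) * \<rho>"
      using V' less(9) by (intro mult_right_mono) auto
    then have d': "2 * real (card (V - {x})) * \<rho> \<le> real d" using less(8) by linarith
    have vars: "clause_vars D \<subseteq> V - {x}" if D: "D \<in> assign m T" "set_literal m = {x}" for D m
    proof -
      obtain E where "E \<in> T" "m \<notin> E" "D = E - {compl m}" 
        using D(1) unfolding assign_def by blast
      then show ?thesis using clause_vars_assign[OF less(4) _ D(2)] by blast
    qed
    have fin: "finite (assign m T)" for m using less(3) by (simp add: assign_def)
    have ref: "der (assign m S) (assign m T) {}" for m
      using der_assign[OF less(5), of m] by simp
    have fatm: "card (fat d (assign m T)) \<le> card {D \<in> fat d T. m \<notin> D}" for m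
    proof -
      have "card (fat d (assign m T)) \<le> card ((\<lambda>D. D - {compl m}) ` {D \<in> fat d T. m \<notin> D})"
        using finfat by (intro card_mono fat_assign_subset finD) auto
      also have "\<dots> \<le> card {D \<in> fat d T. m \<notin> D}" using finfat by (intro card_image_le) auto
      finally show ?thesis .
    qed
    \<comment> \<open>The fat clauses containing \<open>l\<close> disappear; the gained factor
      \<open>1 - \<rho>\<close> pays for lowering \<open>b\<close> by one.\<close>
    have 1: "der (assign l S) (width_le (K + d + b')) {}"
    proof (rule less(1)[OF V' fin vars ref assign_width_le[OF less(6)] less(7) d' less(9,10)])
      have "{D \<in> fat d T. l \<notin> D} = fat d T - {D \<in> fat d T. l \<in> D}" by auto
      then have "card {D \<in> fat d T. l \<notin> D} = card (fat d T) - card {D \<in> fat d T. l \<in> D}"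
        using finfat by (simp add: card_Diff_subset)
      moreover have "card {D \<in> fat d T. l \<in> D} \<le> card (fat d T)"
        using finfat by (intro card_mono) auto
      ultimately have "real (card {D \<in> fat d T. l \<notin> D}) \<le> real (card (fat d T)) * (1 - \<rho>)"
        using l(2) by (simp add: algebra_simps of_nat_diff)
      with fatm[of l] have "real (card (fat d (assign l T))) \<le> real (card (fat d T)) * (1 - \<rho>)"
        by linarith
      then have "real (card (fat d (assign l T))) * (1 - \<rho>) ^ b'
          \<le> real (card (fat d T)) * (1 - \<rho>) * (1 - \<rho>) ^ b'"
        using less(10) by (intro mult_right_mono) auto
      with less(11) b show "real (card (fat d (assign l T))) * (1 - \<rho>) ^ b' < 1"
        by (simp add: mult.assoc)
    qed (use x in auto)
    \<comment> \<open>Here the fat clauses need not become fewer and \<open>b\<close> stays; the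
      induction still advances because a variable is gone.\<close>
    have 2: "der (assign (compl l) S) (width_le (K + d + b)) {}"
    proof (rule less(1)[OF V' fin[of "compl l"] vars[of _ "compl l"] ref[of "compl l"] assign_width_le[OF less(6)] less(7) d' less(9,10)])
      have "card {D \<in> fat d T. compl l \<notin> D} \<le> card (fat d T)"
        using finfat by (intro card_mono) auto
      with fatm[of "compl l"] have "card (fat d (assign (compl l) T)) \<le> card (fat d T)" by linarith
      then have "real (card (fat d (assign (compl l) T))) * (1 - \<rho>) ^ b
          \<le> real (card (fat d T)) * (1 - \<rho>) ^ b"
        using less(10) by (intro mult_right_mono) auto
      with less(11) show "real (card (fat d (assign (compl l) T))) * (1 - \<rho>) ^ b < 1" by linarith
    qed (use x in auto)
    have "S \<subseteq> width_le (K + d + b')" using less(6) width_le_mono[of K "K + d + b'"] by auto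
    from der_branch[OF this 1] 2 b show ?thesis by simp
  qed
qed

section \<open>The random model\<close>

lemma measure_pair_pmf_Times:
  "measure_pmf.prob (pair_pmf p q) (A \<times> B) = measure_pmf.prob p A * measure_pmf.prob q B"
proof -
  \<comment> \<open>Intersecting with the supports makes both sets countable, as the product rule
    requires.\<close>
  have "measure_pmf.prob (pair_pmf p q) (A \<times> B) =
      measure_pmf.prob (pair_pmf p q) ((A \<inter> set_pmf p) \<times> (B \<inter> set_pmf q))"
    by (subst measure_Int_set_pmf[symmetric]) (simp add: Times_Int_Times)
  also have "\<dots> = measure_pmf.prob p (A \<inter> set_pmf p) * measure_pmf.prob q (B \<inter> set_pmf q)"
    by (intro measure_pmf_prob_product) (auto intro: countable_subset)
  finally show ?thesis by (simp add: measure_Int_set_pmf)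
qed

lemma prob_replicate_pmf_prod:
  "measure_pmf.prob (replicate_pmf M p) {l. \<forall>i<M. l ! i \<in> B i} =
     (\<Prod>i<M. measure_pmf.prob p (B i))"
proof (induction M arbitrary: B)
  case 0
  then show ?case by simp
next
  case (Suc M)
  have "replicate_pmf (Suc M) p = map_pmf (\<lambda>(x, xs). x # xs) (pair_pmf p (replicate_pmf M p))"
    by (simp add: pair_pmf_def map_bind_pmf)
  then have "measure_pmf.prob (replicate_pmf (Suc M) p) {l. \<forall>i<Suc M. l ! i \<in> B i} =
      measure_pmf.prob (pair_pmf p (replicate_pmf M p))
        ((\<lambda>(x, xs). x # xs) -` {l. \<forall>i<Suc M. l ! i \<in> B i})"
    by simp
  also have "(\<lambda>(x, xs). x # xs) -` {l. \<forall>i<Suc M. l ! i \<in> B i} =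
      B 0 \<times> {l. \<forall>i<M. l ! i \<in> B (Suc i)}"
    by (auto simp: All_less_Suc2)
  finally show ?case
    using Suc[of "\<lambda>i. B (Suc i)"]
    by (simp add: measure_pair_pmf_Times prod.lessThan_Suc_shift del: prod.lessThan_Suc replicate_pmf.simps)
qed

lemma prob_replicate_pmf_subset:
  assumes "I \<subseteq> {..<M}"
  shows "measure_pmf.prob (replicate_pmf M p) {l. \<forall>i\<in>I. l ! i \<in> A} = measure_pmf.prob p A ^ card I"
proof -
  have "{l. \<forall>i\<in>I. l ! i \<in> A} = {l. \<forall>i<M. l ! i \<in> (if i \<in> I then A else UNIV)}"
    using assms by auto
  then have "measure_pmf.prob (replicate_pmf M p) {l. \<forall>i\<in>I. l ! i \<in> A} =
      (\<Prod>i<M. measure_pmf.prob p (if i \<in> I then A else UNIV))"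
    by (simp only: prob_replicate_pmf_prod)
  also have "\<dots> = (\<Prod>i<M. if i \<in> I then measure_pmf.prob p A else 1)"
    by (intro prod.cong) auto
  also have "\<dots> = (\<Prod>i\<in>{..<M} \<inter> I. measure_pmf.prob p A)"
    by (rule prod.inter_restrict[symmetric]) simp
  also have "{..<M} \<inter> I = I" using assms by auto
  finally show ?thesis by simp
qed

text \<open>This couples random formulas of different lengths: the shorter one is a prefix of the
  longer.\<close>

lemma map_take_replicate_pmf:
  assumes "m \<le> M"
  shows "map_pmf (take m) (replicate_pmf M p) = replicate_pmf m p"
proof -
  have M: "M = m + (M - m)" using assms by simp
  have "map_pmf (take m) (replicate_pmf (m + (M - m)) p) =
      replicate_pmf m p \<bind> (\<lambda>xs. replicate_pmf (M - m) p \<bind> (\<lambda>ys. return_pmf (take m (xs @ ys))))"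
    unfolding replicate_pmf_distrib by (simp add: map_bind_pmf)
  also have "\<dots> = replicate_pmf m p \<bind> (\<lambda>xs. replicate_pmf (M - m) p \<bind> (\<lambda>ys. return_pmf xs))"
    by (intro bind_pmf_cong refl) (auto simp: set_replicate_pmf)
  finally show ?thesis using M by (simp add: bind_return_pmf')
qed

section \<open>Probabilities of a single application\<close>

lemma finite_distinct_orderings:
  assumes "finite V"
  shows "finite {xs. set xs = V \<and> distinct xs}" "{xs. set xs = V \<and> distinct xs} \<noteq> {}"
proof -
  have "{xs. set xs = V \<and> distinct xs} \<subseteq> {xs. set xs \<subseteq> V \<and> length xs \<le> card V}"
    by (auto simp: distinct_card)
  then show "finite {xs. set xs = V \<and> distinct xs}"
    using finite_lists_length_le[OF assms] by (rule finite_subset)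
  show "{xs. set xs = V \<and> distinct xs} \<noteq> {}"
    using finite_distinct_list[OF assms] by auto
qed

abbreviation subsets_pmf :: "nat \<Rightarrow> nat \<Rightarrow> nat set pmf" where
  "subsets_pmf k n \<equiv> pmf_of_set {V. V \<subseteq> {..<n} \<and> card V = k}"

lemma subsets_finite: "finite {V. V \<subseteq> {..<n::nat} \<and> card V = k}"
  by (rule finite_subset[of _ "Pow {..<n}"]) auto

lemma subsets_nonempty:
  assumes "k \<le> n"
  shows "{V. V \<subseteq> {..<n::nat} \<and> card V = k} \<noteq> {}"
  using assms obtain_subset_with_card_n[of k "{..<n}"] by auto

lemma set_random_application:
  assumes "k \<le> n" "(R, xs) \<in> set_pmf (random_application k P n)"
  shows "R \<in> set_pmf P" "length xs = k" "distinct xs" "set xs \<subseteq> {..<n}"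
proof -
  from assms obtain V where V: "V \<subseteq> {..<n}" "card V = k"
      "xs \<in> set_pmf (pmf_of_set {xs. set xs = V \<and> distinct xs})" and R: "R \<in> set_pmf P"
    using set_pmf_of_set[OF subsets_nonempty[OF assms(1)] subsets_finite]
    by (auto simp: random_application_def)
  have "finite V" using V(1) finite_subset by blast
  from set_pmf_of_set[OF finite_distinct_orderings(2,1)[OF this]] V(3)
  have "set xs = V" "distinct xs" by auto
  with V R show "R \<in> set_pmf P" "length xs = k" "distinct xs" "set xs \<subseteq> {..<n}"
    by (auto simp: distinct_card[symmetric])
qed

text \<open>All orderings of \<open>V\<close> have the same set \<open>V\<close>, so forgetting the
  order leaves a uniform \<open>k\<close>-subset and an independent constraint. Event probabilities
  of a single draw are computed from this pair.\<close>

lemma random_application_set_constr: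
  assumes "k \<le> n"
  shows "map_pmf (\<lambda>(R, xs). (set xs, R)) (random_application k P n) = pair_pmf (subsets_pmf k n) P"
proof -
  have "map_pmf (\<lambda>(R, xs). (set xs, R)) (random_application k P n) =
      subsets_pmf k n \<bind> (\<lambda>V. pmf_of_set {xs. set xs = V \<and> distinct xs} \<bind>
        (\<lambda>xs. P \<bind> (\<lambda>R. return_pmf (set xs, R))))"
    by (simp add: random_application_def map_bind_pmf)
  also have "\<dots> = subsets_pmf k n \<bind> (\<lambda>V. pmf_of_set {xs. set xs = V \<and> distinct xs} \<bind>
        (\<lambda>xs. P \<bind> (\<lambda>R. return_pmf (V, R))))"
  proof (intro bind_pmf_cong refl)
    fix V xs R assume "V \<in> set_pmf (subsets_pmf k n)"
      and xs: "xs \<in> set_pmf (pmf_of_set {xs. set xs = V \<and> distinct xs})"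
    then have "V \<subseteq> {..<n}"
      using set_pmf_of_set[OF subsets_nonempty[OF assms] subsets_finite] by auto
    then have "finite V" using finite_subset by blast
    from set_pmf_of_set[OF finite_distinct_orderings(2,1)[OF this]] xs
    show "return_pmf (set xs, R) = return_pmf (V, R)" by auto
  qed
  finally show ?thesis by (simp add: pair_pmf_def)
qed

lemma prob_random_application:
  assumes "k \<le> n" "W \<subseteq> {..<n}"
  shows "measure_pmf.prob (random_application k P n) {(R, xs). set xs \<subseteq> W \<and> R \<in> Q} =
    real (card W choose k) / real (n choose k) * measure_pmf.prob P Q"
proof -
  have fW: "finite W" using assms(2) finite_subset by blast
  have "{(R, xs). set xs \<subseteq> W \<and> R \<in> Q} = (\<lambda>(R, xs). (set xs, R)) -` ({V. V \<subseteq> W} \<times> Q)"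
    by auto
  then have "measure_pmf.prob (random_application k P n) {(R, xs). set xs \<subseteq> W \<and> R \<in> Q} =
     measure_pmf.prob (map_pmf (\<lambda>(R, xs). (set xs, R)) (random_application k P n)) ({V. V \<subseteq> W} \<times> Q)"
    by simp
  also have "\<dots> = measure_pmf.prob (subsets_pmf k n) {V. V \<subseteq> W} * measure_pmf.prob P Q"
    unfolding random_application_set_constr[OF assms(1)] measure_pair_pmf_Times ..
  also have "measure_pmf.prob (subsets_pmf k n) {V. V \<subseteq> W} =
      card ({V. V \<subseteq> {..<n} \<and> card V = k} \<inter> {V. V \<subseteq> W}) / card {V. V \<subseteq> {..<n} \<and> card V = k}"
    by (rule measure_pmf_of_set[OF subsets_nonempty[OF assms(1)] subsets_finite])
  also have "{V. V \<subseteq> {..<n} \<and> card V = k} \<inter> {V. V \<subseteq> W} = {V. V \<subseteq> W \<and> card V = k}"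
    using assms(2) by auto
  finally show ?thesis by (simp add: n_subsets fW)
qed

section \<open>Binomial estimates for the union bound\<close>

lemma binomial_ratio_le:
  assumes "k \<le> n" "1 \<le> k"
  shows "real (s choose k) / real (n choose k) \<le> (real k * real s / real n) ^ k"
proof -
  have n: "0 < real n" using assms by simp
  have "real (s choose k) \<le> real s ^ k"
  proof -
    have "(s choose k) * 1 \<le> (s choose k) * fact k" by (intro mult_le_mono2 fact_ge_1)
    also have "\<dots> \<le> s ^ k" by (rule binomial_fact_pow)
    finally have "s choose k \<le> s ^ k" by simp
    then show ?thesis by (metis of_nat_le_iff of_nat_power)
  qed
  moreover have "(real n / real k) ^ k \<le> real (n choose k)"
    using binomial_ge_n_over_k_pow_k[OF assms(1)] .
  moreover have "0 < (real n / real k) ^ k" using n assms by simp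
  ultimately have "real (s choose k) / real (n choose k) \<le> real s ^ k / (real n / real k) ^ k"
    by (intro frac_le) auto
  also have "\<dots> = (real k * real s / real n) ^ k"
    by (simp add: power_divide power_mult_distrib)
  finally show ?thesis .
qed

lemma binomial_ratio_ge:
  assumes "1 \<le> k" "2 * k \<le> n" "n \<le> 2 * z"
  shows "(1 / (2 * real k)) ^ k \<le> real (z choose k) / real (n choose k)"
proof -
  have k: "k \<le> z" "k \<le> n" "0 < real n" using assms by auto
  have "real (n choose k) \<le> real n ^ k"
    using binomial_le_pow[OF k(2)] by (metis of_nat_le_iff of_nat_power)
  moreover have "(real n / (2 * real k)) ^ k \<le> (real z / real k) ^ k"
    using assms by (intro power_mono) (auto simp: field_simps)
  with binomial_ge_n_over_k_pow_k[OF k(1), where ?'a = real]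
  have "(real n / (2 * real k)) ^ k \<le> real (z choose k)" by linarith
  moreover have "0 < real (n choose k)" using k by simp
  ultimately have "(real n / (2 * real k)) ^ k / real n ^ k \<le> real (z choose k) / real (n choose k)"
    by (intro frac_le) auto
  moreover have "(real n / (2 * real k)) ^ k / real n ^ k = (1 / (2 * real k)) ^ k"
    using k(3) by (simp add: power_divide)
  ultimately show ?thesis by simp
qed

text \<open>A weak form of Stirling's formula: the left side over \<open>fact s\<close> is a single
  term of the exponential series at \<open>s\<close>.\<close>

lemma power_le_exp_fact: "real s ^ s \<le> exp (real s) * fact s"
proof -
  have "real s ^ s / fact s \<le> exp (real s)"
    using sum_le_suminf[OF summable_exp[of "real s"], of "{s}"]
    by (simp add: exp_def divide_inverse scaleR_conv_of_real mult.commute)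
  then show ?thesis by (simp add: field_simps)
qed

lemma binomial_le_power_fact: "real (n choose s) \<le> real n ^ s / fact s"
proof -
  have "real ((n choose s) * fact s) \<le> real (n ^ s)"
    using binomial_fact_pow of_nat_le_iff by blast
  then show ?thesis by (simp add: field_simps)
qed

text \<open>The factors count the choices of \<open>r\<close> constraints and of \<open>s\<close>
  variables and bound the probability that the chosen constraints live on the chosen variables. Up
  to constants to the power r, the choice of constraints costs (n/r)^r and the spare exponent k r -
  s \<ge> 5 r / 4 gains (r/n)^(5 r / 4), so (r/n)^(r/4) remains.\<close>

lemma union_bound_term:
  fixes C :: real
  assumes "1 \<le> k" "1 \<le> r" "1 \<le> n" "real M \<le> C * real n" "0 < C" "s \<le> n" "4 * s + 5 * r \<le> 4 * k * r"
  shows "real (M choose r) * real (n choose s) * ((real k * real s / real n) ^ k) ^ r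
    \<le> (C * exp (real k + 1) * real k ^ k * real k powr (5/4) * (real r / real n) powr (1/4)) ^ r"
proof -
  have pos: "0 < real r" "0 < real n" "0 < real k" using assms by auto
  have "real (M choose r) \<le> real M ^ r / fact r" by (rule binomial_le_power_fact)
  also have "\<dots> \<le> (C * real n) ^ r / fact r"
    using assms by (intro divide_right_mono power_mono) auto
  also have "\<dots> \<le> (C * real n) ^ r * (exp (real r) / real r ^ r)"
  proof -
    have "1 / fact r \<le> exp (real r) / real r ^ r"
      using power_le_exp_fact[of r] pos by (simp add: field_simps)
    then have "(C * real n) ^ r * (1 / fact r) \<le> (C * real n) ^ r * (exp (real r) / real r ^ r)"
      using assms by (intro mult_left_mono) auto
    then show ?thesis by simp
  qed
  also have "\<dots> = (C * exp 1 * (real n / real r)) ^ r"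
    by (simp add: power_mult_distrib power_divide exp_of_nat_mult[symmetric])
  finally have 1: "real (M choose r) \<le> (C * exp 1 * (real n / real r)) ^ r" .
  have skr: "s \<le> k * r" using assms(7) by linarith
  have "((real k * real s / real n) ^ k) ^ r = (real k ^ k) ^ r * (real s / real n) ^ (k * r)"
    by (simp add: power_mult_distrib power_divide power_mult)
  \<comment> \<open>The first \<open>s\<close> factors absorb the number of choices of
    \<open>s\<close> variables, the others provide the decay.\<close>
  also have "(real s / real n) ^ (k * r) = (real s / real n) ^ s * (real s / real n) ^ (k * r - s)"
    using skr by (simp flip: power_add)
  finally have 2: "((real k * real s / real n) ^ k) ^ r =
      (real k ^ k) ^ r * ((real s / real n) ^ s * (real s / real n) ^ (k * r - s))" .
  have "real (n choose s) * (real s / real n) ^ s \<le> real n ^ s / fact s * (real s / real n) ^ s"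
    by (intro mult_right_mono binomial_le_power_fact) auto
  also have "\<dots> = real s ^ s / fact s" using pos by (simp add: power_divide)
  also have "\<dots> \<le> exp (real s)" using power_le_exp_fact[of s] by (simp add: field_simps)
  also have "\<dots> \<le> exp (real k * real r)"
    using skr by (metis exp_le_cancel_iff of_nat_le_iff of_nat_mult)
  also have "\<dots> = exp (real k) ^ r" by (simp add: exp_of_nat2_mult)
  finally have 3: "real (n choose s) * (real s / real n) ^ s \<le> exp (real k) ^ r" .
  have 4: "(real s / real n) ^ (k * r - s) \<le> ((real k * (real r / real n)) powr (5/4)) ^ r"
  proof (cases "s = 0")
    case True
    have "0 < k * r" using assms by simp
    then show ?thesis by (simp add: True zero_power)
  next
    case False
    have "(real s / real n) ^ (k * r - s) = (real s / real n) powr real (k * r - s)"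
      using False pos by (subst powr_realpow) auto
    \<comment> \<open>The base is at most 1, so a lower bound on the exponent gives an upper bound
      on the power.\<close>
    also have "\<dots> \<le> (real s / real n) powr (5 / 4 * real r)"
    proof (rule powr_mono')
      have "4 * real s + 5 * real r \<le> 4 * real k * real r"
        using assms(7) by (metis (mono_tags) of_nat_add of_nat_le_iff of_nat_mult of_nat_numeral)
      then show "5 / 4 * real r \<le> real (k * r - s)"
        using skr by (simp add: of_nat_diff)
    qed (use assms pos in auto)
    also have "\<dots> \<le> (real k * (real r / real n)) powr (5 / 4 * real r)"
    proof (rule powr_mono2)
      have "real s \<le> real k * real r" using skr by (metis of_nat_le_iff of_nat_mult)
      then show "real s / real n \<le> real k * (real r / real n)"
        using pos by (simp add: divide_right_mono)
    qed auto
    also have "\<dots> = ((real k * (real r / real n)) powr (5/4)) ^ r"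
      using pos by (simp add: powr_realpow[symmetric] powr_powr)
    finally show ?thesis .
  qed
  have "real (M choose r) * real (n choose s) * ((real k * real s / real n) ^ k) ^ r =
      real (M choose r) * ((real k ^ k) ^ r * ((real (n choose s) * (real s / real n) ^ s) *
        (real s / real n) ^ (k * r - s)))"
    unfolding 2 by (simp only: mult_ac)
  also have "\<dots> \<le> (C * exp 1 * (real n / real r)) ^ r * ((real k ^ k) ^ r * (exp (real k) ^ r *
        ((real k * (real r / real n)) powr (5/4)) ^ r))"
    using assms by (intro mult_mono 1 3 4 order_refl) auto
  also have "\<dots> = (C * exp 1 * (real n / real r) * real k ^ k * exp (real k) *
      (real k * (real r / real n)) powr (5/4)) ^ r"
    by (simp only: power_mult_distrib mult_ac)
  also have "(real k * (real r / real n)) powr (5/4) =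
      real k powr (5/4) * ((real r / real n) powr (1/4) * (real r / real n))"
  proof -
    have "(real r / real n) powr (5/4) = (real r / real n) powr (1/4 + 1)" by simp
    also have "\<dots> = (real r / real n) powr (1/4) * (real r / real n)"
      using pos by (subst powr_add) simp
    finally show ?thesis using pos by (simp only: powr_mult of_nat_0_le_iff divide_nonneg_nonneg)
  qed
  also have "C * exp 1 * (real n / real r) * real k ^ k * exp (real k) *
      (real k powr (5/4) * ((real r / real n) powr (1/4) * (real r / real n))) =
      C * exp (real k + 1) * real k ^ k * real k powr (5/4) * (real r / real n) powr (1/4)"
    using pos by (simp add: exp_add field_simps)
  finally show ?thesis .
qed

lemma sum_Suc_half_power_le: "(\<Sum>r<R. real (Suc r) * (1/2) ^ r) \<le> 4"
proof -
  \<comment> \<open>The subtracted term is the exact tail of the infinite series, whose sum is 4;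
    with it the induction goes through.\<close>
  have "(\<Sum>r<R. real (Suc r) * (1/2) ^ r) = 4 - (2 * real R + 4) * (1/2) ^ R"
  proof (induction R)
    case (Suc R)
    have step: "4 - (2 * x + 4) * p + (1 + x) * p = 4 - (2 * (1 + x) + 4) * (1/2 * p)" for x p :: real
      by (simp add: algebra_simps)
    have "(\<Sum>r<Suc R. real (Suc r) * (1/2) ^ r) =
        4 - (2 * real R + 4) * (1/2) ^ R + real (Suc R) * (1/2) ^ R"
      by (simp only: sum.lessThan_Suc Suc.IH)
    also have "\<dots> = 4 - (2 * real (Suc R) + 4) * (1/2) ^ Suc R"
      unfolding of_nat_Suc power_Suc by (rule step)
    finally show ?case .
  qed simp
  then show ?thesis by simp
qed

text \<open>Of the \<open>r\<close> equal factors, one is bounded by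
  \<open>B * r * n powr (-1/4)\<close>, which yields the decay in \<open>n\<close>, and the others
  by 1/2, which makes the sum over \<open>r\<close> converge. The bound on \<open>\<eta>\<close> is
  what gives 1/2.\<close>

lemma union_bound_sum:
  fixes B :: real
  assumes "0 < B" "0 < \<eta>" "\<eta> \<le> 1 / (2 * B) ^ 4" "1 \<le> n" "real R \<le> \<eta> * real n"
  shows "(\<Sum>r=1..R. (B * (real r / real n) powr (1/4)) ^ r) \<le> 4 * B * real n powr (-1/4)"
proof -
  have n: "0 < real n" using assms by simp
  have "(\<Sum>r=1..R. (B * (real r / real n) powr (1/4)) ^ r)
      \<le> (\<Sum>r=1..R. B * real n powr (-1/4) * (real r * (1/2) ^ (r - 1)))"
  proof (rule sum_mono)
    fix r assume r: "r \<in> {1..R}"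
    have "real r / real n \<le> \<eta>" using r assms n by (simp add: field_simps)
    then have "(real r / real n) powr (1/4) \<le> (1 / (2 * B) ^ 4) powr (1/4)"
      using assms by (intro powr_mono2) auto
    also have "\<dots> = 1 / (2 * B)"
    proof -
      have "(1 / (2 * B) ^ 4) = (1 / (2 * B)) powr 4"
        using assms by (simp add: power_divide)
      then show ?thesis using assms by (simp only: powr_powr) simp
    qed
    finally have half: "B * (real r / real n) powr (1/4) \<le> 1/2" using assms by (simp add: field_simps)
    have "(real r) powr (1/4) \<le> real r powr 1" using r by (intro powr_mono) auto
    then have "real r powr (1/4) / real n powr (1/4) \<le> real r / real n powr (1/4)"
      by (intro divide_right_mono) auto
    also have "real r / real n powr (1/4) = real r * real n powr (-1/4)"
      using powr_minus_divide[of "real n" "1/4"] by simp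
    finally have "(real r / real n) powr (1/4) \<le> real r * real n powr (-1/4)"
      by (simp only: powr_divide of_nat_0_le_iff)
    then have "B * (real r / real n) powr (1/4) \<le> B * (real r * real n powr (-1/4))"
      using assms(1) by (intro mult_left_mono) auto
    then have one: "B * (real r / real n) powr (1/4) \<le> B * real n powr (-1/4) * real r"
      by (simp only: mult_ac)
    have "(B * (real r / real n) powr (1/4)) ^ r =
        (B * (real r / real n) powr (1/4)) * (B * (real r / real n) powr (1/4)) ^ (r - 1)"
      using r by (cases r) auto
    also have "\<dots> \<le> (B * real n powr (-1/4) * real r) * (1/2) ^ (r - 1)"
      using assms by (intro mult_mono one power_mono half) auto
    finally show "(B * (real r / real n) powr (1/4)) ^ r
      \<le> B * real n powr (-1/4) * (real r * (1/2) ^ (r - 1))" by (simp only: mult.assoc)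
  qed
  also have "\<dots> = B * real n powr (-1/4) * (\<Sum>r=1..R. real r * (1/2) ^ (r - 1))"
    by (simp add: sum_distrib_left)
  also have "(\<Sum>r=1..R. real r * (1/2) ^ (r - 1)) = (\<Sum>r<R. real (Suc r) * (1/2) ^ r)"
    by (rule sum.reindex_bij_witness[of _ Suc "\<lambda>r. r - 1"]) auto
  also have "B * real n powr (-1/4) * \<dots> \<le> B * real n powr (-1/4) * 4"
    using assms by (intro mult_left_mono sum_Suc_half_power_le) auto
  finally show ?thesis by (simp only: mult_ac)
qed

section \<open>Expansion of random formulas\<close>

text \<open>Repeated draws are told apart by their positions in the list, so the union bound can run
  over index sets in place of submultisets.\<close>

lemma submultiset_indices:
  "G \<subseteq># mset l \<Longrightarrow> \<exists>I\<subseteq>{..<length l}. card I = size G \<and> (\<forall>i\<in>I. l ! i \<in># G)"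
proof (induction l arbitrary: G)
  case Nil
  then show ?case by simp
next
  case (Cons a l)
  define H where "H = (if a \<in># G then G - {#a#} else G)"
  have "H \<subseteq># mset l"
  proof (rule mset_subset_eqI)
    fix b
    show "count H b \<le> count (mset l) b"
      using mset_subset_eq_count[OF Cons.prems, of b]
      by (auto simp: H_def not_in_iff split: if_splits)
  qed
  then obtain I where I: "I \<subseteq> {..<length l}" "card I = size H" "\<forall>i\<in>I. l ! i \<in># H"
    using Cons.IH by blast
  have fI: "finite I" using I(1) finite_subset by blast
  have HG: "set_mset H \<subseteq> set_mset G" by (auto simp: H_def dest: in_diffD)
  show ?case
  proof (cases "a \<in># G")
    case True
    then have "size G = Suc (size H)" by (simp add: H_def size_Suc_Diff1)
    then have "card (insert 0 (Suc ` I)) = size G"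
      using fI I(2) by (simp add: card_insert_if card_image)
    with True I HG show ?thesis
      by (intro exI[of _ "insert 0 (Suc ` I)"]) auto
  next
    case False
    then have "card (Suc ` I) = size G" using I(2) by (simp add: card_image H_def)
    with I HG show ?thesis by (intro exI[of _ "Suc ` I"]) auto
  qed
qed

lemma SAT_model_support:
  assumes "k \<le> n" "\<Phi> \<in> set_pmf (SAT_model k P n M)"
  shows "formula_over k (set_pmf P) \<Phi>" "Var \<Phi> \<subseteq> {..<n}"
proof -
  obtain l where l: "\<Phi> = mset l" "set l \<subseteq> set_pmf (random_application k P n)"
    using assms(2) by (auto simp: SAT_model_def set_replicate_pmf)
  show "formula_over k (set_pmf P) \<Phi>" "Var \<Phi> \<subseteq> {..<n}"
    using l set_random_application[OF assms(1)]
    by (fastforce simp: formula_over_def tuples_def Var_def)+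
qed

lemma prob_le_if_support:
  assumes "\<And>x. x \<in> set_pmf p \<Longrightarrow> x \<in> A \<Longrightarrow> x \<in> B"
  shows "measure_pmf.prob p A \<le> measure_pmf.prob p B"
proof -
  have "measure_pmf.prob p A = measure_pmf.prob p (A \<inter> set_pmf p)"
    by (simp add: measure_Int_set_pmf)
  also have "\<dots> \<le> measure_pmf.prob p B"
    using assms by (intro measure_pmf.finite_measure_mono) auto
  finally show ?thesis .
qed

text \<open>Union bound over the size \<open>r\<close>, the positions of \<open>r\<close>
  constraints and a set \<open>W\<close> of \<open>s r\<close> variables, where \<open>s r\<close>
  is the floor of (k - 5/4) r: a subformula of size \<open>r\<close> violates expansion only if its
  variables fit into such a \<open>W\<close>.\<close>

lemma prob_not_expanding_le:
  fixes k :: nat and B C \<eta> :: real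
  defines "B \<equiv> C * exp (real k + 1) * real k ^ k * real k powr (5/4)"
  assumes "1 \<le> k" "k \<le> n" "real M \<le> C * real n" "0 < C"
    and "0 < \<eta>" "\<eta> \<le> 1 / (2 * B) ^ 4" "real k * \<eta> \<le> 1"
  shows "measure_pmf.prob (SAT_model k P n M) {\<Phi>. \<not> expanding k (\<eta> * real n) \<Phi>}
    \<le> 4 * B * real n powr (-1/4)"
\<comment> \<open>For \<open>k = 1\<close> expansion holds trivially, while \<open>4 * k - 5\<close>
  would be truncated to 0 and the bound \<open>s\<close> would fail.\<close>
proof (cases "k = 1")
  case True
  then have "expanding k (\<eta> * real n) \<Phi>" for \<Phi> :: "nat formula"
    by (simp add: expanding_def)
  moreover have "0 \<le> B" using assms by (simp add: B_def)
  ultimately show ?thesis by simp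
next
  case False
  then have k: "2 \<le> k" using assms by simp
  have n: "1 \<le> n" using assms by simp
  have B: "0 < B" using assms by (simp add: B_def)
  define R where "R = nat \<lfloor>\<eta> * real n\<rfloor>"
  have R: "real R \<le> \<eta> * real n" using assms by (simp add: R_def)
  define s where "s r = (4 * k - 5) * r div 4" for r
  have s: "4 * s r + 5 * r \<le> 4 * k * r" for r
  proof -
    have "4 * s r \<le> (4 * k - 5) * r" by (simp add: s_def)
    also have "(4 * k - 5) * r + 5 * r = 4 * k * r" using k by (simp flip: add_mult_distrib)
    finally show ?thesis by simp
  qed
  have sn: "s r \<le> n" if "r \<le> R" for r
  proof -
    have "real (s r) \<le> real (k * r)" using s[of r] by linarith
    also have "\<dots> \<le> real k * (\<eta> * real n)" using that R by (simp add: mult_left_mono)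
    also have "\<dots> \<le> real n" using assms(8) mult_right_mono[of "real k * \<eta>" 1 "real n"] by simp
    finally show ?thesis by simp
  qed
  define p where "p = random_application k P n"
  define A where "A W = {(R :: constr, xs). set xs \<subseteq> W \<and> R \<in> UNIV}" for W :: "nat set"
  define \<I> where "\<I> r = {I. I \<subseteq> {..<M} \<and> card I = r}" for r :: nat
  define \<W> where "\<W> r = {W. W \<subseteq> {..<n} \<and> card W = r}" for r :: nat
  have fin [simp]: "finite (\<I> r)" "finite (\<W> r)" for r
    unfolding \<I>_def \<W>_def by (rule subsets_finite)+
  have cards: "card (\<I> r) = M choose r" "card (\<W> r) = n choose r" for r
    unfolding \<I>_def \<W>_def by (simp_all add: n_subsets)
  define E where "E r = (\<Union>(I, W)\<in>\<I> r \<times> \<W> (s r). {l. \<forall>i\<in>I. l ! i \<in> A W})" for r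
  have E: "measure_pmf.prob (replicate_pmf M p) (E r) \<le> (B * (real r / real n) powr (1/4)) ^ r"
    if r: "r \<in> {1..R}" for r
  proof -
    have "measure_pmf.prob (replicate_pmf M p) (E r) \<le>
      (\<Sum>(I, W)\<in>\<I> r \<times> \<W> (s r). measure_pmf.prob (replicate_pmf M p) {l. \<forall>i\<in>I. l ! i \<in> A W})"
      unfolding E_def case_prod_beta by (rule measure_pmf.finite_measure_subadditive_finite) auto
    also have "\<dots> \<le> (\<Sum>(I, W)\<in>\<I> r \<times> \<W> (s r). ((real k * real (s r) / real n) ^ k) ^ r)"
    proof (rule sum_mono, clarify)
      fix I W assume I: "I \<in> \<I> r" and W: "W \<in> \<W> (s r)"
      have "measure_pmf.prob (replicate_pmf M p) {l. \<forall>i\<in>I. l ! i \<in> A W} =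
          measure_pmf.prob p (A W) ^ r"
        using I prob_replicate_pmf_subset[of I M p "A W"] by (simp add: \<I>_def)
      also have "measure_pmf.prob p (A W) = real (s r choose k) / real (n choose k)"
        using W prob_random_application[OF assms(3), of W P UNIV] by (simp add: A_def p_def \<W>_def)
      also have "\<dots> ^ r \<le> ((real k * real (s r) / real n) ^ k) ^ r"
        using assms by (intro power_mono binomial_ratio_le) auto
      finally show "measure_pmf.prob (replicate_pmf M p) {l. \<forall>i\<in>I. l ! i \<in> A W}
          \<le> ((real k * real (s r) / real n) ^ k) ^ r" .
    qed
    also have "\<dots> = real (M choose r) * real (n choose s r) * ((real k * real (s r) / real n) ^ k) ^ r"
      by (simp add: cards card_cartesian_product)
    also have "\<dots> \<le> (B * (real r / real n) powr (1/4)) ^ r"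
      unfolding B_def using assms r n s sn by (intro union_bound_term) auto
    finally show ?thesis .
  qed
  have "measure_pmf.prob (SAT_model k P n M) {\<Phi>. \<not> expanding k (\<eta> * real n) \<Phi>} =
      measure_pmf.prob (replicate_pmf M p) {l. \<not> expanding k (\<eta> * real n) (mset l)}"
    by (simp add: SAT_model_def p_def)
  also have "\<dots> \<le> measure_pmf.prob (replicate_pmf M p) (\<Union>r\<in>{1..R}. E r)"
  proof (rule prob_le_if_support)
    fix l assume l: "l \<in> set_pmf (replicate_pmf M p)"
      and "l \<in> {l. \<not> expanding k (\<eta> * real n) (mset l)}"
    then obtain G where G: "G \<subseteq># mset l" "real (size G) \<le> \<eta> * real n"
        "\<not> 4 * k * size G \<le> 4 * card (Var G) + 5 * size G"
      by (auto simp: expanding_def)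
    define r where "r = size G"
    have "r \<noteq> 0" using G(3) by (intro notI) (simp add: r_def)
    moreover have "r \<le> R" using G(2) by (simp add: R_def r_def le_nat_floor)
    ultimately have r: "r \<in> {1..R}" by simp
    have len: "length l = M" using l by (simp add: set_replicate_pmf)
    obtain I where I: "I \<subseteq> {..<M}" "card I = r" "\<forall>i\<in>I. l ! i \<in># G"
      using submultiset_indices[OF G(1)] len by (auto simp: r_def)
    have "mset l \<in> set_pmf (SAT_model k P n M)"
      using l by (auto simp: SAT_model_def p_def)
    then have "Var G \<subseteq> {..<n}"
      using SAT_model_support(2)[OF assms(3)] Var_mono[OF set_mset_mono[OF G(1)]] by blast
    moreover have "card (Var G) \<le> s r"
    proof -
      have "4 * card (Var G) < 4 * k * r - 5 * r" using G(3) by (simp add: r_def)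
      then have "card (Var G) * 4 \<le> (4 * k - 5) * r" by (simp add: diff_mult_distrib)
      then show ?thesis by (simp add: s_def less_eq_div_iff_mult_less_eq)
    qed
    \<comment> \<open>The variable set is padded to exactly \<open>s r\<close> elements, the size
      over which \<open>\<W>\<close> counts; \<open>sn\<close> leaves room for this.\<close>
    ultimately obtain W where W: "Var G \<subseteq> W" "W \<subseteq> {..<n}" "card W = s r"
      using exists_subset_between[of "Var G" "s r" "{..<n}"] sn r by auto
    have "\<forall>i\<in>I. l ! i \<in> A W"
      using I(3) W(1) by (fastforce simp: A_def Var_def)
    with I W have "l \<in> E r" unfolding E_def \<I>_def \<W>_def by blast
    with r show "l \<in> (\<Union>r\<in>{1..R}. E r)" by blast
  qed
  also have "\<dots> \<le> (\<Sum>r=1..R. measure_pmf.prob (replicate_pmf M p) (E r))"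
    by (rule measure_pmf.finite_measure_subadditive_finite) auto
  also have "\<dots> \<le> (\<Sum>r=1..R. (B * (real r / real n) powr (1/4)) ^ r)"
    by (intro sum_mono E)
  also have "\<dots> \<le> 4 * B * real n powr (-1/4)"
    using B assms n R by (intro union_bound_sum) auto
  finally show ?thesis .
qed

lemma expanding_whp:
  fixes C :: real
  assumes "1 \<le> k" "0 < C"
  obtains \<eta> B where "0 < \<eta>" "\<eta> \<le> 1"
    "\<And>n M P. k \<le> n \<Longrightarrow> real M \<le> C * real n \<Longrightarrow>
      measure_pmf.prob (SAT_model k P n M) {\<Phi>. \<not> expanding k (\<eta> * real n) \<Phi>}
        \<le> B * real n powr (-1/4)"
proof -
  define B where "B = C * exp (real k + 1) * real k ^ k * real k powr (5/4)"
  \<comment> \<open>The first bound keeps the variable sets of the union bound within the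
    \<open>n\<close> available variables, the second makes its terms decay geometrically. Both
    depend on \<open>k\<close> and \<open>C\<close> only, hence are uniform in \<open>n\<close>,
    \<open>M\<close> and \<open>P\<close>.\<close>
  define \<eta> where "\<eta> = min (1 / real k) (1 / (2 * B) ^ 4)"
  have "0 < B" using assms by (simp add: B_def)
  then have "0 < \<eta>" using assms by (simp add: \<eta>_def)
  have "\<eta> \<le> 1 / real k" by (simp add: \<eta>_def)
  also have "\<dots> \<le> 1" using assms by simp
  finally have "\<eta> \<le> 1" .
  have "real k * \<eta> \<le> real k * (1 / real k)" by (intro mult_left_mono) (simp_all add: \<eta>_def)
  then have "real k * \<eta> \<le> 1" using assms by simp
  moreover have "\<eta> \<le> 1 / (2 * B) ^ 4" by (simp add: \<eta>_def)
  ultimately show ?thesis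
    using that[of \<eta> "4 * B"] \<open>0 < \<eta>\<close> \<open>\<eta> \<le> 1\<close> prob_not_expanding_le[of k _ _ C \<eta>] assms
    unfolding B_def by blast
qed

section \<open>Unsatisfiability at linear density\<close>

text \<open>A constant assignment allowed by all constraints would satisfy every formula, so the
  probability could not tend to 0 above the threshold.\<close>

lemma sharp_threshold_not_valid:
  assumes "sharp_threshold k P"
  shows "\<exists>R\<in>set_pmf P. replicate k b \<notin> R"
proof (rule ccontr)
  assume "\<not> ?thesis"
  then have valid: "replicate k b \<in> R" if "R \<in> set_pmf P" for R using that by blast
  have sat: "prob_sat k P n M = 1" if "k \<le> n" for n M
  proof -
    have "satisfiable \<Phi>" if "\<Phi> \<in> set_pmf (SAT_model k P n M)" for \<Phi>
    proof -
      have "map (\<lambda>_. b) xs \<in> R" if "(R, xs) \<in># \<Phi>" for R xs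
      proof -
        have "R \<in> set_pmf P" "length xs = k"
          using SAT_model_support(1)[OF \<open>k \<le> n\<close> \<open>\<Phi> \<in> _\<close>] that
          by (auto simp: formula_over_def tuples_def)
        then show ?thesis using valid by (simp add: map_replicate_const)
      qed
      then show ?thesis unfolding satisfiable_def satisfies_def by blast
    qed
    then show ?thesis by (auto simp: measure_pmf.prob_eq_1 AE_measure_pmf_iff)
  qed
  obtain c :: "nat \<Rightarrow> real" where c: "\<And>M :: nat \<Rightarrow> nat.
      (\<forall>\<^sub>F n in sequentially. real (M n) > (c n + 1) * real n) \<Longrightarrow>
      (\<lambda>n. prob_sat k P n (M n)) \<longlonglongrightarrow> 0"
    using assms unfolding sharp_threshold_def by (meson zero_less_one)
  \<comment> \<open>The added 1 makes the inequality strict also where the ceiling is exact, as at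
    \<open>n = 0\<close>.\<close>
  define M where "M n = nat \<lceil>(c n + 1) * real n\<rceil> + 1" for n
  have "real (M n) > (c n + 1) * real n" for n
    unfolding M_def by linarith
  then have "(\<lambda>n. prob_sat k P n (M n)) \<longlonglongrightarrow> 0" by (intro c) simp
  moreover have "(\<lambda>n. prob_sat k P n (M n)) \<longlonglongrightarrow> 1"
    using sat by (intro tendsto_eventually eventually_sequentiallyI[of k]) auto
  ultimately show False using LIMSEQ_unique zero_neq_one by blast
qed

text \<open>First moment method: every assignment gives one of the two truth values to at least half of
  the variables, and is then violated with constant probability by \<open>R0\<close> or \<open>R1\<close>.\<close>

lemma prob_sat_first_moment:
  assumes "1 \<le> k" and R0: "R0 \<in> set_pmf P" "replicate k False \<notin> R0"
    and R1: "R1 \<in> set_pmf P" "replicate k True \<notin> R1"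
  obtains q where "0 < q" "q \<le> 1"
    "\<And>n M. 2 * k \<le> n \<Longrightarrow> prob_sat k P n M \<le> 2 ^ n * (1 - q) ^ M"
proof -
  \<comment> \<open>A lower bound for the probability that one draw picks \<open>R0\<close> or
    \<open>R1\<close>, whichever is needed, and places it inside a given set of at least half of the
    variables.\<close>
  define q where "q = min (pmf P R0) (pmf P R1) * (1 / (2 * real k)) ^ k"
  have q0: "0 < q" using assms by (simp add: q_def pmf_positive_iff)
  have "(1 / (2 * real k)) ^ k \<le> 1" using assms by (intro power_le_one) auto
  moreover have "min (pmf P R0) (pmf P R1) \<le> 1" by (simp add: pmf_le_1 min.coboundedI1)
  ultimately have q1: "q \<le> 1" unfolding q_def by (intro mult_le_one) auto
  have main: "prob_sat k P n M \<le> 2 ^ n * (1 - q) ^ M" if n: "2 * k \<le> n" for n M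
  proof -
    have kn: "k \<le> n" using n by simp
    define p where "p = random_application k P n"
    define A where "A Z = {(R :: constr, xs). map (\<lambda>x. x \<in> Z) xs \<in> R}" for Z :: "nat set"
    have violated: "measure_pmf.prob p (A Z) \<le> 1 - q"
      if W: "W \<subseteq> {..<n}" "n \<le> 2 * card W" "\<And>x. x \<in> W \<Longrightarrow> x \<in> Z \<longleftrightarrow> b"
        and R: "R \<in> set_pmf P" "replicate k b \<notin> R" "q \<le> (1 / (2 * real k)) ^ k * pmf P R"
      for Z W b R
    proof -
      have "q \<le> (1 / (2 * real k)) ^ k * pmf P R" by fact
      also have "\<dots> \<le> real (card W choose k) / real (n choose k) * measure_pmf.prob P {R}"
        unfolding measure_pmf_single
        using assms n W by (intro mult_right_mono binomial_ratio_ge) auto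
      also have "\<dots> = measure_pmf.prob p {(R', xs). set xs \<subseteq> W \<and> R' \<in> {R}}"
        unfolding p_def using prob_random_application[OF kn W(1)] by metis
      also have "\<dots> \<le> measure_pmf.prob p (- A Z)"
      proof (rule prob_le_if_support)
        fix c assume c: "c \<in> set_pmf p" "c \<in> {(R', xs). set xs \<subseteq> W \<and> R' \<in> {R}}"
        then obtain xs where xs: "c = (R, xs)" "set xs \<subseteq> W" by auto
        have "length xs = k" using c xs set_random_application(2)[OF kn] by (auto simp: p_def)
        moreover have "map (\<lambda>x. x \<in> Z) xs = map (\<lambda>x. b) xs" using xs W(3) by auto
        ultimately show "c \<in> - A Z" using R(2) xs by (simp add: A_def map_replicate_const)
      qed
      also have "\<dots> = 1 - measure_pmf.prob p (A Z)"
        using measure_pmf.prob_compl[of "A Z" p] by (simp add: Compl_eq_Diff_UNIV)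
      finally show ?thesis by simp
    qed
    have AZ: "measure_pmf.prob p (A Z) \<le> 1 - q" if Z: "Z \<in> Pow {..<n}" for Z
    proof (cases "n \<le> 2 * card Z")
      case True
      show ?thesis
        by (rule violated[of Z Z True R1]) (use True Z R1 in \<open>auto simp: q_def mult.commute mult_right_mono\<close>)
    next
      case False
      have "card ({..<n} - Z) = n - card Z"
        using Z finite_subset[of Z "{..<n}"] by (simp add: card_Diff_subset)
      with False have "n \<le> 2 * card ({..<n} - Z)" by linarith
      then show ?thesis
        by (intro violated[of "{..<n} - Z" Z False R0]) (use Z R0 in \<open>auto simp: q_def mult.commute mult_right_mono\<close>)
    qed
    have "prob_sat k P n M = measure_pmf.prob (replicate_pmf M p) {l. satisfiable (mset l)}"
      by (simp add: SAT_model_def p_def)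
    \<comment> \<open>An assignment is represented by the set \<open>Z\<close> of its true variables
      below \<open>n\<close>, so that only 2^n events are summed although assignments are defined on
      all of \<open>nat\<close>.\<close>
    also have "\<dots> \<le> measure_pmf.prob (replicate_pmf M p)
        (\<Union>Z\<in>Pow {..<n}. {l. \<forall>i\<in>{..<M}. l ! i \<in> A Z})"
    proof (rule prob_le_if_support)
      fix l assume l: "l \<in> set_pmf (replicate_pmf M p)" "l \<in> {l. satisfiable (mset l)}"
      then obtain \<alpha> where \<alpha>: "satisfies \<alpha> (mset l)" by (auto simp: satisfiable_def)
      define Z where "Z = {x \<in> {..<n}. \<alpha> x}"
      have "l ! i \<in> A Z" if "i < M" for i
      proof -
        obtain R xs where Rxs: "l ! i = (R, xs)" by force
        have mem: "(R, xs) \<in> set l"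
          using l that Rxs by (metis (mono_tags, lifting) mem_Collect_eq nth_mem set_replicate_pmf)
        then have "(R, xs) \<in> set_pmf p" using l by (auto simp: set_replicate_pmf)
        then have "set xs \<subseteq> {..<n}" using set_random_application(4)[OF kn] by (simp add: p_def)
        then have "map (\<lambda>x. x \<in> Z) xs = map \<alpha> xs" by (auto simp: Z_def)
        moreover have "map \<alpha> xs \<in> R" using \<alpha> mem by (auto simp: satisfies_def)
        ultimately have "map (\<lambda>x. x \<in> Z) xs \<in> R" by metis
        then show ?thesis using Rxs by (simp add: A_def)
      qed
      moreover have "Z \<in> Pow {..<n}" by (auto simp: Z_def)
      ultimately show "l \<in> (\<Union>Z\<in>Pow {..<n}. {l. \<forall>i\<in>{..<M}. l ! i \<in> A Z})" by blast
    qed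
    also have "\<dots> \<le> (\<Sum>Z\<in>Pow {..<n}. measure_pmf.prob (replicate_pmf M p) {l. \<forall>i\<in>{..<M}. l ! i \<in> A Z})"
      by (rule measure_pmf.finite_measure_subadditive_finite) auto
    also have "\<dots> = (\<Sum>Z\<in>Pow {..<n}. measure_pmf.prob p (A Z) ^ M)"
      by (intro sum.cong refl) (simp only: prob_replicate_pmf_subset[OF order_refl] card_lessThan)
    also have "\<dots> \<le> (\<Sum>Z\<in>Pow {..<n}. (1 - q) ^ M)"
      by (intro sum_mono power_mono AZ) auto
    also have "\<dots> = 2 ^ n * (1 - q) ^ M" by (simp add: card_Pow)
    finally show ?thesis .
  qed
  from that[OF q0 q1 main] show ?thesis .
qed

section \<open>Spine and refutations of random formulas\<close>

lemma ex_submultiset_size: "n \<le> size F \<Longrightarrow> \<exists>G. G \<subseteq># F \<and> size G = n"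
proof (induction F arbitrary: n)
  case (add c F)
  then show ?case
  proof (cases "n \<le> size F")
    case True
    then obtain G where "G \<subseteq># F" "size G = n" using add.IH by blast
    moreover have "F \<subseteq># add_mset c F" by (simp add: subset_mset.less_imp_le)
    ultimately show ?thesis using subset_mset.order_trans by blast
  next
    case False
    with add.prems have "n = size (add_mset c F)" by simp
    then show ?thesis by blast
  qed
qed simp

lemma finite_submultisets: "finite {G. G \<subseteq># F}"
proof (induction F)
  case (add c F)
  have "{G. G \<subseteq># add_mset c F} \<subseteq> {G. G \<subseteq># F} \<union> add_mset c ` {G. G \<subseteq># F}"
  proof
    fix G assume G: "G \<in> {G. G \<subseteq># add_mset c F}"
    show "G \<in> {G. G \<subseteq># F} \<union> add_mset c ` {G. G \<subseteq># F}"
    proof (cases "c \<in># G")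
      case True
      then obtain H where "G = add_mset c H" by (meson mset_add)
      with G show ?thesis by auto
    next
      case False
      have "G \<subseteq># F"
      proof (rule mset_subset_eqI)
        fix a
        show "count G a \<le> count F a"
          using mset_subset_eq_count[of G "add_mset c F" a] G False
          by (auto simp: not_in_iff split: if_splits)
      qed
      then show ?thesis by blast
    qed
  qed
  then show ?case using add.IH by (meson finite_UnI finite_imageI finite_subset)
qed simp

lemma Spine_mono: "\<Phi> \<subseteq># \<Psi> \<Longrightarrow> Spine k \<C> n \<Phi> \<subseteq> Spine k \<C> n \<Psi>"
  unfolding Spine_def using subset_mset.order_trans by blast

lemma finite_Spine [simp]: "finite (Spine k \<C> n \<Phi>)"
  by (rule finite_subset[of _ "{..<n}"]) (auto simp: Spine_def)

text \<open>A minimally unsatisfiable subformula \<open>F\<close> minus any constraint is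
  satisfiable, and adding the constraint back makes it unsatisfiable; so all its variables belong to
  the spine. By expansion \<open>F\<close> has more than \<open>s\<close> constraints, and
  \<open>s\<close> of them already contain at least (k - 5/4) s \<ge> 3 s / 4 variables.\<close>

lemma Spine_card_ge:
  assumes over: "formula_over k \<C> \<Phi>"
    and noimp: "\<And>R D. R \<in> \<C> \<Longrightarrow> implicate k R D \<Longrightarrow> \<not> card D \<le> 2"
    and exp: "expanding k (real s) \<Phi>" and unsat: "\<not> satisfiable \<Phi>" and vars: "Var \<Phi> \<subseteq> {..<n}"
  shows "3 * s \<le> 4 * card (Spine k \<C> n \<Phi>)"
proof -
  obtain F where F: "F \<subseteq># \<Phi>" "entails F {}" "\<And>H. H \<subset># F \<Longrightarrow> \<not> entails H {}"
    using exists_minimal_subformula[of "\<lambda>H. entails H {}" \<Phi>] unsat by (auto simp: entails_empty_iff)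
  have overF: "formula_over k \<C> F" using over F(1) by (rule formula_over_mono)
  have "F \<noteq> {#}" using F(2) by (auto simp: entails_def satisfies_def clause_true_def)
  then have size: "0 < size F" by (simp add: nonempty_has_size)
  have "Var F \<subseteq> Spine k \<C> n \<Phi>"
  proof
    fix x assume "x \<in> Var F"
    then obtain R xs where c: "(R, xs) \<in># F" "x \<in> set xs" by (auto simp: Var_def)
    have "F - {#(R, xs)#} \<subset># F" using c by (simp add: mset_subset_diff_self)
    then have "satisfiable (F - {#(R, xs)#})" using F(3) by (auto simp: entails_empty_iff)
    moreover have "F - {#(R, xs)#} \<subseteq># \<Phi>" using F(1) diff_subset_eq_self subset_mset.order_trans by blast
    moreover have "R \<in> \<C>" "xs \<in> tuples k" using overF c by (auto simp: formula_over_def)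
    moreover have "set xs \<subseteq> {..<n}"
    proof -
      have "set xs \<subseteq> Var F" using c(1) by (auto simp: Var_def)
      then show ?thesis using vars Var_mono[OF set_mset_mono[OF F(1)]] by blast
    qed
    moreover have "\<not> satisfiable (add_mset (R, xs) (F - {#(R, xs)#}))"
      using F(2) c by (simp add: entails_empty_iff)
    ultimately show "x \<in> Spine k \<C> n \<Phi>" using c(2) unfolding Spine_def by blast
  qed
  then have card: "card (Var F) \<le> card (Spine k \<C> n \<Phi>)" by (intro card_mono) auto
  \<comment> \<open>Applied to the empty clause, the bound yields 3 |F| \<le> 2 k |F|, so the mere
    existence of \<open>F\<close> forces k \<ge> 2.\<close>
  have "2 * card (Var F) + 3 * size F \<le> 2 * k * size F + 3 * card ({} :: nat clause)"
    by (rule minimal_entailing_vars[OF overF noimp _ F(2,3)]) auto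
  then have "3 * size F \<le> (2 * k) * size F" unfolding card.empty by linarith
  then have "3 \<le> 2 * k" using size mult_le_cancel2[of 3 "size F" "2 * k"] by blast
  then have k: "2 \<le> k" by linarith
  have "s < size F"
  proof (rule ccontr)
    assume "\<not> s < size F"
    then have "size F \<le> 6 * card ({} :: nat clause)"
      by (intro expanding_minimal_size[OF over noimp exp _ F(1) _ F(2,3)]) auto
    then show False using size by simp
  qed
  \<comment> \<open>Expansion is known up to size \<open>s\<close> only, so it is applied to a part
    of \<open>F\<close> of exactly that size.\<close>
  then obtain G where G: "G \<subseteq># F" "size G = s"
    using ex_submultiset_size[of s F] by auto
  have "4 * k * size G \<le> 4 * card (Var G) + 5 * size G"
    using exp G F(1) subset_mset.order_trans unfolding expanding_def by blast
  moreover have "4 * 2 * s \<le> 4 * k * s" using k by (intro mult_le_mono) auto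
  moreover have "card (Var G) \<le> card (Var F)"
    using G by (intro card_mono Var_mono set_mset_mono) auto
  ultimately show ?thesis using card unfolding G(2) by linarith
qed

section \<open>Size of refutations\<close>

lemma resolution_refutation_vars:
  assumes "resolution_refutation S \<pi>" "\<And>E. E \<in> S \<Longrightarrow> clause_vars E \<subseteq> V" "D \<in> set \<pi>"
  shows "clause_vars D \<subseteq> V"
proof -
  have "clause_vars (\<pi> ! i) \<subseteq> V" if "i < length \<pi>" for i
    using that
  proof (induction i rule: less_induct)
    case (less i)
    from assms(1) less.prems consider "\<pi> ! i \<in> S"
      | j l x where "j < i" "l < i" "\<pi> ! i = resolvent (\<pi> ! j) (\<pi> ! l) x"
      unfolding resolution_refutation_def by blast
    then show ?case
    proof cases
      case 1
      then show ?thesis using assms(2) by blast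
    next
      case 2
      then have "clause_vars (\<pi> ! j) \<subseteq> V" "clause_vars (\<pi> ! l) \<subseteq> V" using less by auto
      then show ?thesis using 2(3) by (auto simp: clause_vars_def resolvent_def)
    qed
  qed
  with assms(3) show ?thesis by (metis in_set_conv_nth)
qed

lemma lit_true_map_literal: "lit_true \<alpha> (map_literal f l) \<longleftrightarrow> lit_true (\<lambda>x. \<alpha> (f x)) l"
  by (cases l) auto

lemma cnf_of_props:
  assumes conv: "cnf_conversion k \<C> enc" and over: "formula_over k \<C> F" and E: "E \<in> cnf_of enc F"
  shows "\<exists>c\<in>#F. entails {#c#} E" "E \<in> width_le (2 * k)" "clause_vars E \<subseteq> Var F"
proof -
  obtain R xs D where c: "(R, xs) \<in># F" and D: "D \<in> enc R" "E = map_literal (\<lambda>i. xs ! i) ` D"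
    using E by (auto simp: cnf_of_def)
  have xs: "R \<in> \<C>" "length xs = k" using over c by (auto simp: formula_over_def tuples_def)
  have cl: "finite D" "clause_vars D \<subseteq> {..<k}"
    and sem: "\<And>\<alpha>. map \<alpha> [0..<k] \<in> R \<Longrightarrow> clause_true \<alpha> D"
    using conv xs(1) D(1) unfolding cnf_conversion_def is_clause_def clause_vars_def by blast+
  have "clause_true \<alpha> E" if "map \<alpha> xs \<in> R" for \<alpha>
  proof -
    have "map (\<lambda>i. \<alpha> (xs ! i)) [0..<k] = map \<alpha> xs"
      using xs(2) by (intro nth_equalityI) auto
    with that have "clause_true (\<lambda>i. \<alpha> (xs ! i)) D" by (intro sem) simp
    then show ?thesis by (auto simp: D(2) clause_true_def lit_true_map_literal)
  qed
  with c show "\<exists>c\<in>#F. entails {#c#} E" by (intro bexI[of _ "(R, xs)"]) (auto simp: entails_def satisfies_def)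
  \<comment> \<open>Both literals of each position are counted: a crude bound, but any bound
    independent of \<open>n\<close> serves.\<close>
  have "card D \<le> card (Pos ` {..<k} \<union> Neg ` {..<k})"
    using cl by (intro card_mono clause_subset_lits) auto
  also have "\<dots> \<le> 2 * k"
    using card_Un_le[of "Pos ` {..<k}" "Neg ` {..<k}"] card_image_le[of "{..<k}" Pos]
      card_image_le[of "{..<k}" Neg] by simp
  finally show "E \<in> width_le (2 * k)"
    using card_image_le[OF cl(1), of "map_literal (\<lambda>i. xs ! i)"] cl(1)
    by (auto simp: width_le_def D(2))
  have "clause_vars E = (\<lambda>i. xs ! i) ` clause_vars D"
    by (auto simp: D(2) clause_vars_def literal.set_map)
  also have "\<dots> \<subseteq> set xs" using cl(2) xs(2) by auto
  also have "\<dots> \<subseteq> Var F" using c by (auto simp: Var_def)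
  finally show "clause_vars E \<subseteq> Var F" .
qed

text \<open>Otherwise \<open>size_width\<close> would turn \<open>\<pi>\<close> into a derivation of
  width \<open>2 * k + d + b\<close>, which \<open>expanding_width_bound\<close> excludes. All
  clauses of \<open>\<pi>\<close> are counted as if they were fat.\<close>

lemma refutation_size_ge:
  assumes over: "formula_over k \<C> F"
    and noimp: "\<And>R D. R \<in> \<C> \<Longrightarrow> implicate k R D \<Longrightarrow> \<not> card D \<le> 2"
    and vars: "Var F \<subseteq> {..<n}" and exp: "expanding k (2 * real s) F"
    and conv: "cnf_conversion k \<C> enc" and ref: "resolution_refutation (cnf_of enc F) \<pi>"
    and par: "1 \<le> s" "6 * (2 * k + d + b) \<le> s" "1 \<le> d" "2 * real n * \<rho> \<le> real d" "0 \<le> \<rho>" "\<rho> < 1"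
  shows "1 \<le> real (length \<pi>) * (1 - \<rho>) ^ b"
proof (rule ccontr)
  assume small: "\<not> ?thesis"
  note cnf = cnf_of_props[OF conv over]
  have "card (fat d (set \<pi>)) \<le> length \<pi>"
    using card_mono[of "set \<pi>" "fat d (set \<pi>)"] card_length[of \<pi>] by (auto simp: fat_def)
  then have "real (card (fat d (set \<pi>))) * (1 - \<rho>) ^ b \<le> real (length \<pi>) * (1 - \<rho>) ^ b"
    using par by (intro mult_right_mono) auto
  then have "real (card (fat d (set \<pi>))) * (1 - \<rho>) ^ b < 1" using small by linarith
  moreover have "clause_vars D \<subseteq> {..<n}" if "D \<in> set \<pi>" for D
    using resolution_refutation_vars[OF ref _ that] cnf(3) vars by blast
  moreover have "cnf_of enc F \<subseteq> width_le (2 * k)" using cnf(2) by blast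
  ultimately have "der (cnf_of enc F) (width_le (2 * k + d + b)) {}"
    using par resolution_refutation_der[OF ref] by (intro size_width[of "{..<n}" "set \<pi>"]) auto
  moreover have "\<not> der (cnf_of enc F) (width_le (2 * k + d + b)) {}"
    by (rule expanding_width_bound[OF over noimp exp par(1) cnf(1)])
      (use par(2) in \<open>auto simp: width_le_def\<close>)
  ultimately show False by blast
qed

lemma refutation_size_exponential:
  assumes over: "formula_over k \<C> F"
    and noimp: "\<And>R D. R \<in> \<C> \<Longrightarrow> implicate k R D \<Longrightarrow> \<not> card D \<le> 2"
    and vars: "Var F \<subseteq> {..<n}" and exp: "expanding k (\<eta> * real n) F"
    and conv: "cnf_conversion k \<C> enc" and ref: "resolution_refutation (cnf_of enc F) \<pi>"
    and \<eta>: "0 < \<eta>" "\<eta> \<le> 1" and n: "100 + 48 * real k \<le> \<eta> * real n"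
  shows "2 powr (\<eta> / 192 * (\<eta> / 96) * real n) \<le> real (length \<pi>)"
proof -
  \<comment> \<open>\<open>2 * s\<close> must stay in the range of expansion, hence the half. With
    \<open>m\<close> for both \<open>d\<close> and \<open>b\<close> the width condition asks for 12
    k + 12 m \<le> s, and m \<le> \<eta> n / 48 spends about half of \<open>s\<close> on the second
    term. The choice \<eta> / 192 for \<rho> then gives 2 n \<rho> = \<eta> n / 96 \<le> m; the
    lower bound on \<eta> n absorbs the rounding.\<close>
  define s where "s = nat \<lfloor>\<eta> * real n / 2\<rfloor>"
  define m where "m = nat \<lfloor>\<eta> * real n / 48\<rfloor>"
  have s: "real s \<le> \<eta> * real n / 2" "\<eta> * real n / 2 - 1 < real s"
    using n unfolding s_def by linarith+
  have m: "real m \<le> \<eta> * real n / 48" "\<eta> * real n / 48 - 1 < real m"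
    using n unfolding m_def by linarith+
  have m96: "\<eta> * real n / 96 \<le> real m" using m n by linarith
  have "expanding k (2 * real s) F"
    using exp s(1) unfolding expanding_def by fastforce
  moreover have "1 \<le> s" using s n by linarith
  moreover have "6 * (2 * k + m + m) \<le> s"
  proof -
    have "12 * real m \<le> \<eta> * real n / 4" using m(1) by linarith
    moreover have "12 * real k + 1 \<le> \<eta> * real n / 4" using n by linarith
    ultimately have "12 * real k + 12 * real m \<le> real s" using s(2) by linarith
    then have "real (6 * (2 * k + m + m)) \<le> real s" by simp
    then show ?thesis by (simp only: of_nat_le_iff)
  qed
  moreover have "1 \<le> m" using m96 n by linarith
  moreover have "2 * real n * (\<eta> / 192) \<le> real m" using m96 by simp
  ultimately have "1 \<le> real (length \<pi>) * (1 - \<eta> / 192) ^ m"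
    using \<eta> by (intro refutation_size_ge[OF over noimp vars _ conv ref]) auto
  also have "\<dots> \<le> real (length \<pi>) * exp (- (\<eta> / 192)) ^ m"
    using \<eta> exp_ge_add_one_self[of "- (\<eta> / 192)"] by (intro mult_left_mono power_mono) auto
  also have "exp (- (\<eta> / 192)) ^ m = exp (- (\<eta> / 192) * real m)"
    by (rule exp_of_nat2_mult[symmetric])
  also have "\<dots> = inverse (exp (\<eta> / 192 * real m))"
    unfolding mult_minus_left by (rule exp_minus)
  finally have len: "exp (\<eta> / 192 * real m) \<le> real (length \<pi>)"
    by (simp only: divide_inverse[symmetric] le_divide_eq_1_pos exp_gt_zero)
  have "2 powr (\<eta> / 192 * (\<eta> / 96) * real n) = exp (\<eta> / 192 * (\<eta> / 96) * real n * ln 2)"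
    by (simp add: powr_def)
  also have "\<eta> / 192 * (\<eta> / 96) * real n * ln 2 \<le> \<eta> / 192 * (\<eta> / 96) * real n * 1"
    using \<eta> ln_2_less_1 by (intro mult_left_mono) auto
  also have "\<dots> = \<eta> / 192 * (\<eta> * real n / 96)" by simp
  also have "\<dots> \<le> \<eta> / 192 * real m" using \<eta> m96 by (intro mult_left_mono) auto
  finally show ?thesis using len by simp
qed

section \<open>Asymptotic statements\<close>

lemma powr_neg_quarter_tendsto_0: "(\<lambda>n. real n powr (-1/4)) \<longlonglongrightarrow> 0"
  by (rule tendsto_neg_powr) (auto simp: filterlim_real_sequentially)

lemma tendsto_1_if_prob_ge:
  assumes "eventually (\<lambda>n. 1 - f n \<le> measure_pmf.prob (p n) (A n)) sequentially" "f \<longlonglongrightarrow> 0"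
  shows "(\<lambda>n. measure_pmf.prob (p n) (A n)) \<longlonglongrightarrow> 1"
proof (rule tendsto_sandwich[OF assms(1)])
  show "(\<lambda>n. 1 - f n) \<longlonglongrightarrow> 1" using tendsto_diff[OF tendsto_const assms(2), of 1] by simp
qed auto

lemma exponential_resolution_complexity_if_no_short_implicate:
  assumes "1 \<le> k"
    and noimp: "\<And>R D. R \<in> set_pmf P \<Longrightarrow> implicate k R D \<Longrightarrow> \<not> card D \<le> 2"
    and conv: "cnf_conversion k (set_pmf P) enc"
  shows "exponential_resolution_complexity k P enc"
  unfolding exponential_resolution_complexity_def
proof (intro allI impI)
  fix c :: real assume "0 < c"
  obtain \<eta> B where \<eta>: "0 < \<eta>" "\<eta> \<le> 1" and exp: "\<And>n M P. k \<le> n \<Longrightarrow> real M \<le> c * real n \<Longrightarrow>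
      measure_pmf.prob (SAT_model k P n M) {\<Phi>. \<not> expanding k (\<eta> * real n) \<Phi>}
        \<le> B * real n powr (-1/4)"
    using expanding_whp[OF assms(1) \<open>0 < c\<close>] by blast
  define \<xi> where "\<xi> = \<eta> / 192 * (\<eta> / 96)"
  define M where "M n = nat \<lfloor>c * real n\<rfloor>" for n :: nat
  define N where "N = max k (nat \<lceil>(100 + 48 * real k) / \<eta>\<rceil>)"
  have "1 - B * real n powr (-1/4) \<le> measure_pmf.prob (SAT_model k P n (M n))
      {\<Phi>. \<forall>\<pi>. resolution_refutation (cnf_of enc \<Phi>) \<pi> \<longrightarrow> 2 powr (\<xi> * real n) \<le> real (length \<pi>)}"
    (is "_ \<le> measure_pmf.prob ?p ?A") if "N \<le> n" for n
  proof -
    have kn: "k \<le> n" using that by (simp add: N_def)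
    have "(100 + 48 * real k) / \<eta> \<le> real n" using that unfolding N_def by linarith
    then have n: "100 + 48 * real k \<le> \<eta> * real n" using \<eta> by (simp add: field_simps)
    have M: "real (M n) \<le> c * real n" using \<open>0 < c\<close> by (simp add: M_def)
    have "1 - B * real n powr (-1/4) \<le> 1 - measure_pmf.prob ?p {\<Phi>. \<not> expanding k (\<eta> * real n) \<Phi>}"
      using exp[OF kn M] by simp
    also have "\<dots> = measure_pmf.prob ?p {\<Phi>. expanding k (\<eta> * real n) \<Phi>}"
      using measure_pmf.prob_compl[of "{\<Phi>. \<not> expanding k (\<eta> * real n) \<Phi>}" ?p]
      by (simp add: Diff_eq Collect_neg_eq)
    also have "\<dots> \<le> measure_pmf.prob ?p ?A"
    proof (rule prob_le_if_support, clarify)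
      fix \<Phi> \<pi>
      assume \<Phi>: "\<Phi> \<in> set_pmf ?p" "expanding k (\<eta> * real n) \<Phi>"
        and \<pi>: "resolution_refutation (cnf_of enc \<Phi>) \<pi>"
      note supp = SAT_model_support[OF kn \<Phi>(1)]
      show "2 powr (\<xi> * real n) \<le> real (length \<pi>)"
        unfolding \<xi>_def
        by (rule refutation_size_exponential[OF supp(1) noimp supp(2) \<Phi>(2) conv \<pi> \<eta> n])
    qed
    finally show ?thesis .
  qed
  then have "(\<lambda>n. measure_pmf.prob (SAT_model k P n (M n))
      {\<Phi>. \<forall>\<pi>. resolution_refutation (cnf_of enc \<Phi>) \<pi> \<longrightarrow> 2 powr (\<xi> * real n) \<le> real (length \<pi>)})
      \<longlonglongrightarrow> 1"
    using tendsto_mult_right_zero[OF powr_neg_quarter_tendsto_0]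
    by (intro tendsto_1_if_prob_ge[of "\<lambda>n. B * real n powr (-1/4)"] eventually_sequentiallyI)
  moreover have "0 < \<xi>" using \<eta> by (simp add: \<xi>_def)
  ultimately show "\<exists>\<xi>>0. (\<lambda>n. measure_pmf.prob (SAT_model k P n (nat \<lfloor>c * real n\<rfloor>))
      {\<Phi>. \<forall>\<pi>. resolution_refutation (cnf_of enc \<Phi>) \<pi> \<longrightarrow> 2 powr (\<xi> * real n) \<le> real (length \<pi>)})
      \<longlonglongrightarrow> 1"
    unfolding M_def by blast
qed

text \<open>Both formulas are read off the same list of draws, the smaller one as a prefix, so an
  upward closed event passes from the smaller to the larger.\<close>

lemma SAT_model_prefix:
  assumes "m \<le> M" "\<And>\<Phi> \<Psi>. \<Phi> \<subseteq># \<Psi> \<Longrightarrow> \<Phi> \<in> A \<Longrightarrow> \<Psi> \<in> A"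
  shows "measure_pmf.prob (SAT_model k P n m) A \<le> measure_pmf.prob (SAT_model k P n M) A"
proof -
  let ?q = "replicate_pmf M (random_application k P n)"
  have "SAT_model k P n m = map_pmf (\<lambda>l. mset (take m l)) ?q"
    unfolding SAT_model_def map_take_replicate_pmf[OF assms(1), symmetric] map_pmf_comp ..
  then have "measure_pmf.prob (SAT_model k P n m) A = measure_pmf.prob ?q {l. mset (take m l) \<in> A}"
    by (simp add: vimage_def)
  also have "\<dots> \<le> measure_pmf.prob ?q {l. mset l \<in> A}"
  proof (rule measure_pmf.finite_measure_mono)
    have "mset (take m l) \<subseteq># mset l" for l :: "(constr \<times> nat list) list"
      using mset_subset_eq_add_left[of "mset (take m l)" "mset (drop m l)"]
      by (simp flip: mset_append)
    then show "{l. mset (take m l) \<in> A} \<subseteq> {l. mset l \<in> A}" using assms(2) by blast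
  qed simp
  also have "\<dots> = measure_pmf.prob (SAT_model k P n M) A"
    by (simp add: SAT_model_def vimage_def)
  finally show ?thesis .
qed

lemma first_order_phase_transition_if_no_short_implicate:
  assumes "1 \<le> k"
    and noimp: "\<And>R D. R \<in> set_pmf P \<Longrightarrow> implicate k R D \<Longrightarrow> \<not> card D \<le> 2"
    and R0: "R0 \<in> set_pmf P" "replicate k False \<notin> R0"
    and R1: "R1 \<in> set_pmf P" "replicate k True \<notin> R1"
  shows "first_order_phase_transition k P"
proof -
  obtain q where q: "0 < q" "q \<le> 1"
    and fm: "\<And>n M. 2 * k \<le> n \<Longrightarrow> prob_sat k P n M \<le> 2 ^ n * (1 - q) ^ M"
    using prob_sat_first_moment[OF assms(1) R0 R1] by blast
  \<comment> \<open>The factor 2 / q brings the first moment bound 2^n (1 - q)^(L n) down to (2 /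
    exp 2)^n, whose base is below 1.\<close>
  define L where "L n = nat \<lceil>2 / q * real n\<rceil>" for n :: nat
  define C where "C = 2 / q + 1"
  have C: "0 < C" using q by (simp add: C_def add_pos_pos)
  obtain \<eta> B where \<eta>: "0 < \<eta>" "\<eta> \<le> 1" and exp: "\<And>n M P. k \<le> n \<Longrightarrow> real M \<le> C * real n \<Longrightarrow>
      measure_pmf.prob (SAT_model k P n M) {\<Phi>. \<not> expanding k (\<eta> * real n) \<Phi>}
        \<le> B * real n powr (-1/4)"
    using expanding_whp[OF assms(1) C] by blast
  have sat_L: "prob_sat k P n (L n) \<le> (2 / exp 2) ^ n" if "2 * k \<le> n" for n
  proof -
    have "prob_sat k P n (L n) \<le> 2 ^ n * (1 - q) ^ L n" by (rule fm[OF that])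
    also have "(1 - q) ^ L n \<le> exp (- q) ^ L n"
      using q exp_ge_add_one_self[of "- q"] by (intro power_mono) auto
    also have "exp (- q) ^ L n = exp (- (q * real (L n)))"
      by (simp add: exp_of_nat2_mult[symmetric])
    also have "\<dots> \<le> exp (- (2 * real n))"
    proof -
      have "2 / q * real n \<le> real (L n)" unfolding L_def by linarith
      then have "q * (2 / q * real n) \<le> q * real (L n)" using q by (intro mult_left_mono) auto
      then show ?thesis using q by simp
    qed
    also have "exp (- (2 * real n)) = inverse (exp 2 ^ n)"
      unfolding exp_of_nat2_mult[symmetric] by (rule exp_minus)
    also have "2 ^ n * inverse (exp 2 ^ n) = (2 / exp 2 :: real) ^ n"
      by (simp only: divide_inverse power_mult_distrib power_inverse)
    finally show ?thesis by simp
  qed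
  have "(\<lambda>n. measure_pmf.prob (SAT_model k P n (M n))
      {\<Phi>. \<eta> / 4 \<le> real (card (Spine k (set_pmf P) n \<Phi>)) / real n}) \<longlonglongrightarrow> 1"
    if M: "(\<lambda>n. prob_sat k P n (M n)) \<longlonglongrightarrow> 0" for M :: "nat \<Rightarrow> nat"
  proof -
    \<comment> \<open>The term 2 / \<eta> ensures \<eta> n \<ge> 2. Then 3 s \<ge> \<eta> n for the
      floor s of \<eta> n, which turns \<open>Spine_card_ge\<close> into the fraction \<eta> /
      4.\<close>
    define N where "N = max (2 * k) (nat \<lceil>2 / \<eta>\<rceil> + 1)"
    define f where "f n = prob_sat k P n (M n) + (2 / exp 2) ^ n + B * real n powr (-1/4)" for n
    have "1 - f n \<le> measure_pmf.prob (SAT_model k P n (M n))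
      {\<Phi>. \<eta> / 4 \<le> real (card (Spine k (set_pmf P) n \<Phi>)) / real n}" (is "_ \<le> measure_pmf.prob _ ?A")
      if n: "N \<le> n" for n
    proof -
      have kn: "2 * k \<le> n" "k \<le> n" using n by (simp_all add: N_def)
      have n0: "0 < real n" using kn assms(1) by simp
      have "2 / \<eta> \<le> real n" using n unfolding N_def by linarith
      then have n\<eta>: "2 \<le> \<eta> * real n" using \<eta> by (simp add: field_simps)
      define m where "m = min (M n) (L n)"
      let ?p = "SAT_model k P n m"
      have sat: "measure_pmf.prob ?p {\<Phi>. satisfiable \<Phi>} \<le> prob_sat k P n (M n) + (2 / exp 2) ^ n"
      proof (cases "M n \<le> L n")
        case True
        then show ?thesis by (simp add: m_def)
      next
        case False
        then show ?thesis
          using sat_L[OF kn(1)] by (simp add: m_def add_increasing)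
      qed
      have "real (L n) \<le> 2 / q * real n + 1" using q unfolding L_def by simp
      then have "real m \<le> C * real n"
        using n0 by (simp add: m_def C_def algebra_simps)
      from exp[OF kn(2) this]
      have ex: "measure_pmf.prob ?p {\<Phi>. \<not> expanding k (\<eta> * real n) \<Phi>} \<le> B * real n powr (-1/4)" .
      have "1 = measure_pmf.prob ?p UNIV" by simp
      also have "\<dots> \<le> measure_pmf.prob ?p
          (?A \<union> ({\<Phi>. satisfiable \<Phi>} \<union> {\<Phi>. \<not> expanding k (\<eta> * real n) \<Phi>}))"
      proof (rule prob_le_if_support)
        fix \<Phi> assume \<Phi>: "\<Phi> \<in> set_pmf ?p"
        have "\<Phi> \<in> ?A" if unsat: "\<not> satisfiable \<Phi>" and e: "expanding k (\<eta> * real n) \<Phi>"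
        proof -
          define s where "s = nat \<lfloor>\<eta> * real n\<rfloor>"
          have s: "real s \<le> \<eta> * real n" "\<eta> * real n - 1 < real s"
            using n\<eta> unfolding s_def by linarith+
          have "expanding k (real s) \<Phi>" using e s(1) unfolding expanding_def by fastforce
          then have "3 * s \<le> 4 * card (Spine k (set_pmf P) n \<Phi>)"
            using SAT_model_support[OF kn(2) \<Phi>] unsat noimp by (intro Spine_card_ge) auto
          then have "3 * real s \<le> 4 * real (card (Spine k (set_pmf P) n \<Phi>))" by linarith
          then have "\<eta> * real n \<le> 4 * real (card (Spine k (set_pmf P) n \<Phi>))"
            using s n\<eta> by linarith
          then show ?thesis using n0 by (simp add: field_simps)
        qed
        then show "\<Phi> \<in> ?A \<union> ({\<Phi>. satisfiable \<Phi>} \<union> {\<Phi>. \<not> expanding k (\<eta> * real n) \<Phi>})" by blast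
      qed
      also have "\<dots> \<le> measure_pmf.prob ?p ?A + (measure_pmf.prob ?p {\<Phi>. satisfiable \<Phi>}
          + measure_pmf.prob ?p {\<Phi>. \<not> expanding k (\<eta> * real n) \<Phi>})"
        by (intro order_trans[OF measure_Un_le] add_left_mono measure_Un_le) auto
      also have "measure_pmf.prob ?p ?A \<le> measure_pmf.prob (SAT_model k P n (M n)) ?A"
      proof (rule SAT_model_prefix)
        fix \<Phi> \<Psi> :: "nat formula" assume "\<Phi> \<subseteq># \<Psi>" "\<Phi> \<in> ?A"
        moreover from this have "card (Spine k (set_pmf P) n \<Phi>) \<le> card (Spine k (set_pmf P) n \<Psi>)"
          by (intro card_mono Spine_mono) auto
        ultimately show "\<Psi> \<in> ?A"
          using n0 by (auto simp: field_simps)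
      qed (simp add: m_def)
      finally show ?thesis using sat ex by (simp add: f_def)
    qed
    moreover have "f \<longlonglongrightarrow> 0"
    proof -
      have "2 < exp (2 :: real)" using exp_ge_add_one_self[of "2 :: real"] by linarith
      then have "(\<lambda>n. (2 / exp 2 :: real) ^ n) \<longlonglongrightarrow> 0" by (intro LIMSEQ_power_zero) simp
      from tendsto_add[OF tendsto_add[OF M this] tendsto_mult_right_zero[OF powr_neg_quarter_tendsto_0, of B]]
      show ?thesis unfolding f_def by simp
    qed
    ultimately show ?thesis by (intro tendsto_1_if_prob_ge[of f] eventually_sequentiallyI)
  qed
  moreover have "0 < \<eta> / 4" using \<eta> by simp
  ultimately show ?thesis unfolding first_order_phase_transition_def by blast
qed

text \<open>\<open>F\<close> itself is one of the competitors in the maximum, and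
  \<open>minimal_entailing_vars\<close> for the empty clause bounds its ratio.\<close>

lemma c_star_ge:
  assumes over: "formula_over k \<C> F"
    and noimp: "\<And>R D. R \<in> \<C> \<Longrightarrow> implicate k R D \<Longrightarrow> \<not> card D \<le> 2"
    and min: "minimally_unsat F"
  shows "2 / (2 * real k - 3) \<le> c_star F"
proof -
  have ent: "entails F {}" "\<And>G. G \<subset># F \<Longrightarrow> \<not> entails G {}"
    using min by (auto simp: minimally_unsat_def entails_empty_iff)
  have "F \<noteq> {#}" using ent(1) by (auto simp: entails_def satisfies_def clause_true_def)
  then have size: "0 < size F" by (simp add: nonempty_has_size)
  have bound: "2 * card (Var F) + 3 * size F \<le> 2 * k * size F"
    using minimal_entailing_vars[OF over noimp _ ent] by simp
  \<comment> \<open>As for the spine, k \<ge> 2 follows. It makes the denominator positive and gives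
    \<open>F\<close> at least one variable.\<close>
  then have "3 * size F \<le> (2 * k) * size F" by linarith
  then have "3 \<le> 2 * k" using size mult_le_cancel2[of 3 "size F" "2 * k"] by blast
  then have k: "2 \<le> k" by linarith
  obtain R xs where c: "(R, xs) \<in># F" using \<open>F \<noteq> {#}\<close> by (metis multiset_nonemptyE surj_pair)
  then have "length xs = k" "set xs \<subseteq> Var F"
    using over by (auto simp: formula_over_def tuples_def Var_def)
  then have "Var F \<noteq> {}" using k by auto
  then have var: "0 < card (Var F)" by (simp add: card_gt_0_iff)
  have "real (2 * card (Var F) + 3 * size F) \<le> real (2 * k * size F)"
    using bound by (rule of_nat_mono)
  then have "2 * real (card (Var F)) \<le> (2 * real k - 3) * real (size F)"
    by (simp add: algebra_simps)
  then have "2 / (2 * real k - 3) \<le> real (size F) / real (card (Var F))"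
    using k var by (simp add: field_simps)
  also have "\<dots> \<le> c_star F"
    unfolding c_star_def
  proof (rule Max_ge)
    have "{real (size G) / real (card (Var G)) | G. G \<noteq> {#} \<and> G \<subseteq># F} \<subseteq>
        (\<lambda>G. real (size G) / real (card (Var G))) ` {G. G \<subseteq># F}" by auto
    then show "finite {real (size G) / real (card (Var G)) | G. G \<noteq> {#} \<and> G \<subseteq># F}"
      by (rule finite_subset) (simp add: finite_submultisets)
  qed (use \<open>F \<noteq> {#}\<close> in auto)
  finally show ?thesis .
qed

theorem theorem5:
  fixes k :: nat and P :: "constr pmf"
  assumes "\<And>R. R \<in> set_pmf P \<Longrightarrow> is_constraint k R"
    and "sharp_threshold k P"
    and "\<And>R D. R \<in> set_pmf P \<Longrightarrow> implicate k R D \<Longrightarrow> \<not> card D \<le> 2"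
  shows "((\<forall>F :: nat formula. formula_over k (set_pmf P) F \<longrightarrow> minimally_unsat F \<longrightarrow>
             c_star F \<ge> 2 / (2 * real k - 3)) \<and>
          first_order_phase_transition k P) \<and>
         (\<forall>enc. cnf_conversion k (set_pmf P) enc \<longrightarrow> exponential_resolution_complexity k P enc)"
proof -
  obtain R0 where R0: "R0 \<in> set_pmf P" "replicate k False \<notin> R0"
    using sharp_threshold_not_valid[OF assms(2)] by blast
  obtain R1 where R1: "R1 \<in> set_pmf P" "replicate k True \<notin> R1"
    using sharp_threshold_not_valid[OF assms(2)] by blast
  \<comment> \<open>For \<open>k = 0\<close> the only constraint is \<open>{[]}\<close>, which
    contains \<open>replicate 0 False\<close>.\<close>
  have "k \<noteq> 0"
    using assms(1)[OF R0(1)] R0(2) by (auto simp: is_constraint_def)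
  then have k: "1 \<le> k" by simp
  show ?thesis
  proof (intro conjI allI impI)
    fix F :: "nat formula" assume "formula_over k (set_pmf P) F" "minimally_unsat F"
    then show "2 / (2 * real k - 3) \<le> c_star F"
      using assms(3) by (intro c_star_ge[of k "set_pmf P" F]) blast+
  next
    show "first_order_phase_transition k P"
      using k assms(3) R0 R1 by (rule first_order_phase_transition_if_no_short_implicate)
  next
    fix enc assume "cnf_conversion k (set_pmf P) enc"
    with k assms(3) show "exponential_resolution_complexity k P enc"
      by (rule exponential_resolution_complexity_if_no_short_implicate)
  qed
qed

end
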